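(* Let $(\mathbf{G},\cdot)$ be a nilpotent group, let $\mathcal{F}$ be an idempotent filter on $\mathbf{G}$, and let $\mathcal{P}$ be a good collection of $\mathcal{F}$-measurable polynomial mappings $\mathcal{F}(\mathbb{N})\to\mathbf{G}$. Then for all $P_1,\ldots,P_k\in\mathcal{P}$ and every $\mathcal{F}$-syndetic set $A\subset\mathbf{G}$ there exist $\alpha\in\mathcal{F}(\mathbb{N})$ and $a\in\mathbf{G}$ such that $\{P_1(\alpha)a,\ldots,P_k(\alpha)a\}\subset A$.
   Context: $\mathcal{F}(X)$ denotes the collection of all non-empty finite subsets of a set $X$; for $\alpha,\beta\in\mathcal{F}(\mathbb{N})$ write $\alpha<\beta$ if $\max\alpha<\min\beta$. A map $x:\mathcal{F}(\mathbb{N})\to\mathbf{G}$ is an IP mapping if $x(\alpha\cup\beta)=x(\alpha)x(\beta)$ whenever $\alpha<\beta$. Let $\mathbb{E}=\{V\subset\mathcal{F}(\mathbb{N}):\exists\beta\text{ with }\{\alpha\in\mathcal{F}(\mathbb{N}):\alpha>\beta\}\subset V\}$; two maps $x,y:\mathcal{F}(\mathbb{N})\to\mathbf{G}$ are equal $\mathbb{E}$-a.e. if $\{\alpha:x(\alpha)=y(\alpha)\}\in\mathbb{E}$. For $x:\mathcal{F}(\mathbb{N})\to\mathbf{G}$ and $\beta\in\mathcal{F}(\mathbb{N})$, the derivative is $D_\beta x(\alpha)=x(\alpha)^{-1}x(\alpha\cup\beta)x(\beta)^{-1}$. A map $P$ is a polynomial mapping of degree $1$ if it equals some IP mapping $\mathbb{E}$-a.e.;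 for $d>1$, $P$ is a polynomial mapping of degree $d$ if $\{\beta: D_\beta P\text{ is a polynomial mapping of degree }d-1\}\in\mathbb{E}$. A polynomial mapping is one of some degree $d\ge1$. A filter on $\mathbf{G}$ is a nonempty family of subsets not containing $\emptyset$, closed under supersets and finite intersections. The product of filters is defined by $A\in\mathcal{F}\cdot\mathcal{G}$ iff $\{x:\{y:xy\in A\}\in\mathcal{G}\}\in\mathcal{F}$; $\mathcal{F}$ is idempotent if $\mathcal{F}\cdot\mathcal{F}\supset\mathcal{F}$. A set $A\subset\mathbf{G}$ is $\mathcal{F}$-syndetic if for every $V\in\mathcal{F}$ there is a finite non-empty $K\subset V$ with $K^{-1}A=\{k^{-1}a:k\in K,a\in A\}\in\mathcal{F}$. A map $x:\mathcal{F}(\mathbb{N})\to\mathbf{G}$ is $\mathcal{F}$-measurable if $x^{-1}(V\cup\{1_{\mathbf{G}}\})\in\mathbb{E}$ for all $V\in\mathcal{F}$. Write $u^c=c^{-1}uc$ and $[u,c]=u^{-1}c^{-1}uc$ (applied pointwise to mappings). A collection $\mathcal{P}$ of polynomial mappings into $\mathbf{G}$ is a good collection of $\mathcal{F}$-measurable polynomial mappings if: (I) the constant map $1_{\mathbf{G}}$ is in $\mathcal{P}$; (II) every $P\in\mathcal{P}$ is $\mathcal{F}$-measurable; (III) for all $R,P\in\mathcal{P}$, $\{c\in\mathbf{G}:R^c[c,P]\in\mathcal{P}\}\in\mathcal{F}$; (IV) for all $R,P\in\mathcal{P}$ there are $C\in\mathcal{F}$ and $\mathcal{T}\in\mathbb{E}$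 such that $(R\,D_\beta P)^c\in\mathcal{P}$ for all $c\in C$ and $\beta\in\mathcal{T}$. *)

theory Defs
  imports "HOL-Algebra.Coset" "HOL-Algebra.Generated_Groups"
begin

definition conjugate :: "('a, 'b) monoid_scheme \<Rightarrow> 'a \<Rightarrow> 'a \<Rightarrow> 'a" where
  "conjugate G u c = inv\<^bsub>G\<^esub> c \<otimes>\<^bsub>G\<^esub> u \<otimes>\<^bsub>G\<^esub> c"

definition commutator :: "('a, 'b) monoid_scheme \<Rightarrow> 'a \<Rightarrow> 'a \<Rightarrow> 'a" where
  "commutator G u c = inv\<^bsub>G\<^esub> u \<otimes>\<^bsub>G\<^esub> inv\<^bsub>G\<^esub> c \<otimes>\<^bsub>G\<^esub> u \<otimes>\<^bsub>G\<^esub> c"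

primrec lower_central_series :: "('a, 'b) monoid_scheme \<Rightarrow> nat \<Rightarrow> 'a set" where
  "lower_central_series G 0 = carrier G"
| "lower_central_series G (Suc n) =
     generate G {commutator G u c | u c. u \<in> lower_central_series G n \<and> c \<in> carrier G}"

definition nilpotent_group :: "('a, 'b) monoid_scheme \<Rightarrow> bool" where
  "nilpotent_group G \<longleftrightarrow> group G \<and> (\<exists>n. lower_central_series G n = {\<one>\<^bsub>G\<^esub>})"

definition FN :: "nat set set" where
  "FN = {\<alpha>. finite \<alpha> \<and> \<alpha> \<noteq> {}}"

definition fin_less :: "nat set \<Rightarrow> nat set \<Rightarrow> bool" where
  "fin_less \<alpha> \<beta> \<longleftrightarrow> Max \<alpha> < Min \<beta>"

definition EE :: "nat set set set" where
  "EE = {V. V \<subseteq> FN \<and> (\<exists>\<beta>\<in>FN. {\<alpha>\<in>FN. fin_less \<beta> \<alpha>} \<subseteq> V)}"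

text \<open>
  Maps from the finite non-empty sets of naturals to the group are extensional functions on
  \<^const>\<open>FN\<close>, so that equality of functions is equality of maps and membership in a collection
  of maps does not depend on values outside \<^const>\<open>FN\<close>.
\<close>

definition ip_mapping :: "('a, 'b) monoid_scheme \<Rightarrow> (nat set \<Rightarrow> 'a) \<Rightarrow> bool" where
  "ip_mapping G x \<longleftrightarrow> x \<in> FN \<rightarrow>\<^sub>E carrier G \<and>
     (\<forall>\<alpha>\<in>FN. \<forall>\<beta>\<in>FN. fin_less \<alpha> \<beta> \<longrightarrow> x (\<alpha> \<union> \<beta>) = x \<alpha> \<otimes>\<^bsub>G\<^esub> x \<beta>)"

definition eq_ae :: "(nat set \<Rightarrow> 'a) \<Rightarrow> (nat set \<Rightarrow> 'a) \<Rightarrow> bool" where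
  "eq_ae x y \<longleftrightarrow> {\<alpha>\<in>FN. x \<alpha> = y \<alpha>} \<in> EE"

definition derivative ::
    "('a, 'b) monoid_scheme \<Rightarrow> nat set \<Rightarrow> (nat set \<Rightarrow> 'a) \<Rightarrow> nat set \<Rightarrow> 'a" where
  "derivative G \<beta> x =
     (\<lambda>\<alpha>\<in>FN. inv\<^bsub>G\<^esub> (x \<alpha>) \<otimes>\<^bsub>G\<^esub> x (\<alpha> \<union> \<beta>) \<otimes>\<^bsub>G\<^esub> inv\<^bsub>G\<^esub> (x \<beta>))"

text \<open>Degrees start at 1, so no map has degree 0 in this sense.\<close>

fun polynomial_of_degree ::
    "('a, 'b) monoid_scheme \<Rightarrow> nat \<Rightarrow> (nat set \<Rightarrow> 'a) \<Rightarrow> bool" where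
  "polynomial_of_degree G 0 P \<longleftrightarrow> False"
| "polynomial_of_degree G (Suc 0) P \<longleftrightarrow>
     P \<in> FN \<rightarrow>\<^sub>E carrier G \<and> (\<exists>x. ip_mapping G x \<and> eq_ae P x)"
| "polynomial_of_degree G (Suc (Suc d)) P \<longleftrightarrow>
     P \<in> FN \<rightarrow>\<^sub>E carrier G \<and>
     {\<beta>\<in>FN. polynomial_of_degree G (Suc d) (derivative G \<beta> P)} \<in> EE"

definition polynomial_mapping :: "('a, 'b) monoid_scheme \<Rightarrow> (nat set \<Rightarrow> 'a) \<Rightarrow> bool" where
  "polynomial_mapping G P \<longleftrightarrow> (\<exists>d\<ge>1. polynomial_of_degree G d P)"

definition filter_on :: "('a, 'b) monoid_scheme \<Rightarrow> 'a set set \<Rightarrow> bool" where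
  "filter_on G F \<longleftrightarrow> F \<subseteq> Pow (carrier G) \<and> F \<noteq> {} \<and> {} \<notin> F \<and>
     (\<forall>U V. U \<in> F \<longrightarrow> U \<subseteq> V \<longrightarrow> V \<subseteq> carrier G \<longrightarrow> V \<in> F) \<and>
     (\<forall>U\<in>F. \<forall>V\<in>F. U \<inter> V \<in> F)"

definition filter_prod :: "('a, 'b) monoid_scheme \<Rightarrow> 'a set set \<Rightarrow> 'a set set \<Rightarrow> 'a set set" where
  "filter_prod G F H =
     {A. A \<subseteq> carrier G \<and> {x\<in>carrier G. {y\<in>carrier G. x \<otimes>\<^bsub>G\<^esub> y \<in> A} \<in> H} \<in> F}"

definition idempotent_filter :: "('a, 'b) monoid_scheme \<Rightarrow> 'a set set \<Rightarrow> bool" where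
  "idempotent_filter G F \<longleftrightarrow> filter_on G F \<and> F \<subseteq> filter_prod G F F"

definition syndetic :: "('a, 'b) monoid_scheme \<Rightarrow> 'a set set \<Rightarrow> 'a set \<Rightarrow> bool" where
  "syndetic G F A \<longleftrightarrow> A \<subseteq> carrier G \<and>
     (\<forall>V\<in>F. \<exists>K. finite K \<and> K \<noteq> {} \<and> K \<subseteq> V \<and> (set_inv\<^bsub>G\<^esub> K) <#>\<^bsub>G\<^esub> A \<in> F)"

definition filter_measurable ::
    "('a, 'b) monoid_scheme \<Rightarrow> 'a set set \<Rightarrow> (nat set \<Rightarrow> 'a) \<Rightarrow> bool" where
  "filter_measurable G F x \<longleftrightarrow> (\<forall>V\<in>F. {\<alpha>\<in>FN. x \<alpha> \<in> V \<union> {\<one>\<^bsub>G\<^esub>}} \<in> EE)"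

definition good_collection ::
    "('a, 'b) monoid_scheme \<Rightarrow> 'a set set \<Rightarrow> (nat set \<Rightarrow> 'a) set \<Rightarrow> bool" where
  "good_collection G F \<P> \<longleftrightarrow>
     (\<forall>P\<in>\<P>. polynomial_mapping G P) \<and>
     (\<lambda>\<alpha>\<in>FN. \<one>\<^bsub>G\<^esub>) \<in> \<P> \<and>
     (\<forall>P\<in>\<P>. filter_measurable G F P) \<and>
     (\<forall>R\<in>\<P>. \<forall>P\<in>\<P>.
        {c\<in>carrier G.
          (\<lambda>\<alpha>\<in>FN. conjugate G (R \<alpha>) c \<otimes>\<^bsub>G\<^esub> commutator G c (P \<alpha>)) \<in> \<P>} \<in> F) \<and>
     (\<forall>R\<in>\<P>. \<forall>P\<in>\<P>. \<exists>C\<in>F. \<exists>T\<in>EE. \<forall>c\<in>C. \<forall>\<beta>\<in>T.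
        (\<lambda>\<alpha>\<in>FN. conjugate G (R \<alpha> \<otimes>\<^bsub>G\<^esub> derivative G \<beta> P \<alpha>) c) \<in> \<P>)"

end

theory Submission
  imports Defs
begin

text \<open>
  The proof is a polynomial exhaustion (PET) induction combined with colour focusing. A finite system
  of maps \<open>P\<^sub>1, \<dots>, P\<^sub>k\<close> is measured by the quotients \<open>P\<^sub>i P\<^sub>k\<^sup>-\<^sup>1\<close>: these lie in a descending chain of
  groups of polynomial maps attached to the lower central series (stretched by the maximal degree),
  and the weight counts their leading terms at each level of the chain.

  Given a syndetic set \<open>B\<close>, the translates by the inverses of a finite set \<open>K\<close> cover a member of the
  filter, so generic points are coloured by \<open>K\<close>. One constructs \<open>\<alpha>\<^sub>1 < \<alpha>\<^sub>2 < \<dots>\<close> and points \<open>f\<^sub>m\<close> such that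
  with \<open>\<beta> = \<alpha>\<^sub>n\<^sub>+\<^sub>1 \<union> \<dots> \<union> \<alpha>\<^sub>m\<close> and \<open>c\<close> the colour of \<open>f\<^sub>n\<close>, all points
  \<open>(P\<^sub>i P\<^sub>k\<^sup>-\<^sup>1)(\<beta>) c f\<^sub>m\<close>, \<open>i < k\<close>, lie in \<open>B\<close>. Passing from \<open>m\<close> to \<open>m + 1\<close> requires solving a
  system whose quotients are, up to terms of deeper level,
  \<open>P\<^sub>i P\<^sub>k\<^sup>-\<^sup>1\<close> divided by one \<open>P\<^sub>1 P\<^sub>k\<^sup>-\<^sup>1\<close> of the deepest level, which has smaller weight. As soon as
  two of the \<open>f\<^sub>n\<close> share a colour, \<open>\<alpha> = \<beta>\<close> and \<open>a = P\<^sub>k(\<beta>)\<^sup>-\<^sup>1 c f\<^sub>m\<close> are as desired. The sets of admissible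
  continuations are kept in an ultrafilter from a minimal left ideal, so that they can be replaced
  by syndetic sets when the induction hypothesis is applied.
\<close>

section \<open>The lower central series\<close>

context group
begin

lemma inv_cancel_left [simp]:
  "\<lbrakk>x \<in> carrier G; y \<in> carrier G\<rbrakk> \<Longrightarrow> inv x \<otimes> (x \<otimes> y) = y"
  "\<lbrakk>x \<in> carrier G; y \<in> carrier G\<rbrakk> \<Longrightarrow> x \<otimes> (inv x \<otimes> y) = y"
  by (simp_all add: m_assoc [symmetric])

lemma conjugate_closed [simp]:
  "\<lbrakk>x \<in> carrier G; y \<in> carrier G\<rbrakk> \<Longrightarrow> conjugate G x y \<in> carrier G"
  by (simp add: conjugate_def)

lemma commutator_closed [simp]:
  "\<lbrakk>x \<in> carrier G; y \<in> carrier G\<rbrakk> \<Longrightarrow> commutator G x y \<in> carrier G"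
  by (simp add: commutator_def)

lemmas word_simps = commutator_def conjugate_def m_assoc inv_mult_group

lemma conjugate_eq_mult_commutator:
  "\<lbrakk>x \<in> carrier G; y \<in> carrier G\<rbrakk> \<Longrightarrow> conjugate G x y = x \<otimes> commutator G x y"
  by (simp add: word_simps)

lemma commutator_swap:
  "\<lbrakk>x \<in> carrier G; y \<in> carrier G\<rbrakk> \<Longrightarrow> commutator G x y = inv (commutator G y x)"
  by (simp add: word_simps)

text \<open>The Hall-Witt identity, solved for one of its three factors; it drives the
  three-subgroup argument in \<open>lower_central_series_commutator\<close>.\<close>

lemma Hall_Witt:
  assumes "x \<in> carrier G" "u \<in> carrier G" "c \<in> carrier G"
  shows "conjugate G (commutator G (commutator G u c) x) (inv c) =
    inv (conjugate G (commutator G (commutator G x (inv u)) (inv c)) u) \<otimes>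
    inv (conjugate G (commutator G (commutator G (inv c) (inv x)) u) x)"
  using assms by (simp add: word_simps)

text \<open>A conjugate of a commutator is the commutator of the conjugates, so normality passes
  from one term to the generators of the next; hence both claims share one induction.\<close>

lemma lower_central_series_normal:
  "subgroup (lower_central_series G n) G \<and>
   (\<forall>x\<in>lower_central_series G n. \<forall>g\<in>carrier G. conjugate G x g \<in> lower_central_series G n)"
proof (induction n)
  case 0
  then show ?case by (auto simp: subgroup_self)
next
  case (Suc n)
  let ?S = "{commutator G u c | u c. u \<in> lower_central_series G n \<and> c \<in> carrier G}"
  have sub: "lower_central_series G n \<subseteq> carrier G"
    using Suc by (simp add: subgroup.subset)
  then have S: "?S \<subseteq> carrier G"
    by auto
  have sg: "subgroup (generate G ?S) G"
    by (rule generate_is_subgroup [OF S])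
  have "conjugate G x g \<in> generate G ?S" if "x \<in> generate G ?S" "g \<in> carrier G" for x g
    using that(1)
  proof (induction rule: generate.induct)
    case one
    then show ?case using that(2) generate.one [of G ?S] by (simp add: conjugate_def)
  next
    case (incl y)
    then obtain u c where y: "y = commutator G u c" "u \<in> lower_central_series G n" "c \<in> carrier G"
      by blast
    have u: "u \<in> carrier G" using y sub by blast
    have "conjugate G y g = commutator G (conjugate G u g) (conjugate G c g)"
      using y u that(2) by (simp add: word_simps)
    also have "\<dots> \<in> ?S"
      using y u that(2) Suc conjugate_closed by blast
    finally show ?case by (rule generate.incl)
  next
    case (inv y)
    then obtain u c where y: "y = commutator G u c" "u \<in> lower_central_series G n" "c \<in> carrier G"
      by blast
    have u: "u \<in> carrier G" using y sub by blast
    have "conjugate G (inv y) g = inv (commutator G (conjugate G u g) (conjugate G c g))"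
      using y u that(2) by (simp add: word_simps)
    moreover have "commutator G (conjugate G u g) (conjugate G c g) \<in> ?S"
      using y u that(2) Suc conjugate_closed by blast
    ultimately show ?case by (simp add: generate.inv)
  next
    case (eng a b)
    have "a \<in> carrier G" "b \<in> carrier G"
      using eng.hyps generate_in_carrier [OF S] by auto
    then have "conjugate G (a \<otimes> b) g = conjugate G a g \<otimes> conjugate G b g"
      using that(2) by (simp add: word_simps)
    then show ?case using eng.IH by (simp add: generate.eng)
  qed
  with sg show ?case by simp
qed

lemma commutator_in_lower_central_series:
  "\<lbrakk>u \<in> lower_central_series G n; c \<in> carrier G\<rbrakk>
    \<Longrightarrow> commutator G u c \<in> lower_central_series G (Suc n)"
  by (auto intro: generate.incl)

declare lower_central_series.simps(2) [simp del]

lemmas lower_central_series_subgroup = lower_central_series_normal [THEN conjunct1]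

lemma lower_central_series_conjugate:
  "\<lbrakk>x \<in> lower_central_series G n; g \<in> carrier G\<rbrakk> \<Longrightarrow> conjugate G x g \<in> lower_central_series G n"
  using lower_central_series_normal by blast

lemma lower_central_series_carrier:
  "x \<in> lower_central_series G n \<Longrightarrow> x \<in> carrier G"
  using lower_central_series_subgroup subgroup.subset by blast

lemma lower_central_series_Suc_subset:
  "lower_central_series G (Suc n) \<subseteq> lower_central_series G n"
proof -
  have "commutator G u c \<in> lower_central_series G n"
    if "u \<in> lower_central_series G n" "c \<in> carrier G" for u c
  proof -
    have "commutator G u c = inv u \<otimes> conjugate G u c"
      using that lower_central_series_carrier by (simp add: word_simps)
    then show ?thesis
      using that by (simp add: lower_central_series_conjugate lower_central_series_subgroup
          subgroup.m_closed subgroup.m_inv_closed)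
  qed
  then have "{commutator G u c | u c. u \<in> lower_central_series G n \<and> c \<in> carrier G}
      \<subseteq> lower_central_series G n"
    by blast
  from generate_subgroup_incl [OF this lower_central_series_subgroup] show ?thesis
    by (simp add: lower_central_series.simps(2))
qed

lemma lower_central_series_antimono:
  "m \<le> n \<Longrightarrow> lower_central_series G n \<subseteq> lower_central_series G m"
  by (rule lift_Suc_antimono_le [of "lower_central_series G"])
    (use lower_central_series_Suc_subset in auto)

text \<open>The three-subgroup argument, by induction on \<open>b\<close>. The series is indexed
  from 0, the whole group, which accounts for the \<open>Suc\<close>.\<close>

lemma lower_central_series_commutator:
  assumes "x \<in> lower_central_series G a" "y \<in> lower_central_series G b"
  shows "commutator G x y \<in> lower_central_series G (Suc (a + b))"
  using assms
proof (induction b arbitrary: a x y)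
  case 0
  then show ?case
    using commutator_in_lower_central_series by simp
next
  case (Suc b)
  let ?N = "lower_central_series G (Suc (a + Suc b))"
  interpret N: subgroup ?N G
    by (rule lower_central_series_subgroup)
  have x: "x \<in> carrier G"
    using Suc.prems lower_central_series_carrier by blast
  \<comment> \<open>For a generator [u, c], the Hall-Witt identity expresses [[u, c], x] up to
    conjugation through [[x, u^-1], c^-1] and [[c^-1, x^-1], u], both within reach of the induction
    hypothesis.\<close>
  have witt: "commutator G x (commutator G u c) \<in> ?N"
    if u: "u \<in> lower_central_series G b" and c: "c \<in> carrier G" for u c
  proof -
    have uc: "u \<in> carrier G"
      using u lower_central_series_carrier by blast
    have "commutator G x (inv u) \<in> lower_central_series G (Suc (a + b))"
      by (rule Suc.IH [OF Suc.prems(1) subgroup.m_inv_closed [OF lower_central_series_subgroup u]])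
    then have 1: "commutator G (commutator G x (inv u)) (inv c) \<in> ?N"
      using commutator_in_lower_central_series c by simp
    have "inv x \<in> lower_central_series G a"
      by (rule subgroup.m_inv_closed [OF lower_central_series_subgroup Suc.prems(1)])
    then have "commutator G (inv x) (inv c) \<in> lower_central_series G (Suc a)"
      using commutator_in_lower_central_series c by simp
    then have "commutator G (inv c) (inv x) \<in> lower_central_series G (Suc a)"
      using commutator_swap [of "inv c" "inv x"] x c
        subgroup.m_inv_closed [OF lower_central_series_subgroup] by simp
    from Suc.IH [OF this u]
    have 2: "commutator G (commutator G (inv c) (inv x)) u \<in> ?N"
      by simp
    have "conjugate G (commutator G (commutator G u c) x) (inv c) \<in> ?N"
      unfolding Hall_Witt [OF x uc c]
      using 1 2 x uc by (intro N.m_closed N.m_inv_closed lower_central_series_conjugate)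
    from lower_central_series_conjugate [OF this c]
    have "commutator G (commutator G u c) x \<in> ?N"
      using x uc c by (simp add: conjugate_def m_assoc)
    then show ?thesis
      using commutator_swap [of x "commutator G u c"] x uc c N.m_inv_closed by simp
  qed
  have S: "{commutator G u c | u c. u \<in> lower_central_series G b \<and> c \<in> carrier G} \<subseteq> carrier G"
    using lower_central_series_carrier by auto
  have inv_right: "commutator G x (inv y) \<in> ?N" if "commutator G x y \<in> ?N" "y \<in> carrier G" for y
  proof -
    have "commutator G x (inv y) = conjugate G (inv (commutator G x y)) (inv y)"
      using x that(2) by (simp add: word_simps)
    then show ?thesis
      using that lower_central_series_conjugate N.m_inv_closed by simp
  qed
  have "y \<in> generate G {commutator G u c | u c. u \<in> lower_central_series G b \<and> c \<in> carrier G}"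
    using Suc.prems(2) unfolding lower_central_series.simps(2) .
  then show ?case
  proof (induction rule: generate.induct)
    case one
    have "commutator G x \<one> = \<one>" using x by (simp add: commutator_def)
    then show ?case using N.one_closed by simp
  next
    case (incl y)
    then show ?case using witt by blast
  next
    case (inv y)
    then have "commutator G x y \<in> ?N" "y \<in> carrier G" using witt S by blast+
    then show ?case by (rule inv_right)
  next
    case (eng y z)
    have "y \<in> carrier G" "z \<in> carrier G"
      using eng.hyps generate_in_carrier [OF S] by auto
    then have "commutator G x (y \<otimes> z) = commutator G x z \<otimes> conjugate G (commutator G x y) z"
      using x by (simp add: word_simps)
    then show ?case
      using eng.IH \<open>z \<in> carrier G\<close> lower_central_series_conjugate N.m_closed by simp
  qed
qed

end

section \<open>Almost all finite sets of natural numbers\<close>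

text \<open>
  The empty set belongs to every tail. Maps are extended by \<open>\<one>\<close> to it, and properties holding almost
  everywhere may be evaluated there; this excludes functions of \<open>Max \<alpha>\<close>, which are almost everywhere
  invariant under all shifts \<open>\<alpha> \<mapsto> \<alpha> \<union> \<beta>\<close> and would otherwise count as polynomial of degree 0.
\<close>

definition tails :: "nat set filter" where
  "tails = (INF N. principal {\<alpha>. finite \<alpha> \<and> \<alpha> \<subseteq> {N..}})"

lemma eventually_tails:
  "eventually P tails \<longleftrightarrow> (\<exists>N. \<forall>\<alpha>. finite \<alpha> \<longrightarrow> \<alpha> \<subseteq> {N..} \<longrightarrow> P \<alpha>)"
proof -
  have "eventually P tails \<longleftrightarrow> (\<exists>N\<in>UNIV. eventually P (principal {\<alpha>. finite \<alpha> \<and> \<alpha> \<subseteq> {N..}}))"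
    unfolding tails_def
  proof (rule eventually_INF_base)
    fix a b :: nat
    show "\<exists>x\<in>UNIV. principal {\<alpha>. finite \<alpha> \<and> \<alpha> \<subseteq> {x..}}
        \<le> inf (principal {\<alpha>. finite \<alpha> \<and> \<alpha> \<subseteq> {a..}}) (principal {\<alpha>. finite \<alpha> \<and> \<alpha> \<subseteq> {b..}})"
      by (rule bexI [of _ "max a b"]) auto
  qed simp
  then show ?thesis by (simp add: eventually_principal Ball_def imp_conjL)
qed

lemma eventually_tails_empty: "eventually P tails \<Longrightarrow> P {}"
  by (auto simp: eventually_tails)

lemma eventually_tails_finite: "eventually finite tails"
  by (auto simp: eventually_tails)

lemma eventually_tails_ge: "eventually (\<lambda>\<alpha>. \<alpha> \<subseteq> {N..}) tails"
  by (auto simp: eventually_tails)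

lemma eventually_tails_greater:
  assumes "finite \<beta>" "\<beta> \<noteq> {}"
  shows "eventually (\<lambda>\<alpha>. \<alpha> \<noteq> {} \<longrightarrow> fin_less \<beta> \<alpha>) tails"
  unfolding eventually_tails
proof (intro exI allI impI)
  fix \<alpha> :: "nat set"
  assume \<alpha>: "finite \<alpha>" "\<alpha> \<subseteq> {Suc (Max \<beta>)..}" "\<alpha> \<noteq> {}"
  then have "Min \<alpha> \<in> {Suc (Max \<beta>)..}"
    using Min_in by blast
  then show "fin_less \<beta> \<alpha>"
    by (simp add: fin_less_def)
qed

lemma EE_eventually_tails:
  assumes "V \<in> EE"
  shows "eventually (\<lambda>\<alpha>. \<alpha> \<noteq> {} \<longrightarrow> \<alpha> \<in> V) tails"
proof -
  from assms obtain \<beta> where \<beta>: "\<beta> \<in> FN" "{\<alpha>\<in>FN. fin_less \<beta> \<alpha>} \<subseteq> V"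
    by (auto simp: EE_def)
  have "eventually (\<lambda>\<alpha>. \<alpha> \<noteq> {} \<longrightarrow> fin_less \<beta> \<alpha>) tails"
    using \<beta>(1) by (intro eventually_tails_greater) (auto simp: FN_def)
  with eventually_tails_finite show ?thesis
    by eventually_elim (use \<beta>(2) in \<open>auto simp: FN_def\<close>)
qed

lemma eventually_tails_union:
  assumes "eventually P tails"
  shows "eventually (\<lambda>\<beta>. eventually (\<lambda>\<alpha>. P (\<alpha> \<union> \<beta>)) tails) tails"
proof -
  from assms obtain N where N: "\<And>\<alpha>. finite \<alpha> \<Longrightarrow> \<alpha> \<subseteq> {N..} \<Longrightarrow> P \<alpha>"
    by (auto simp: eventually_tails)
  show ?thesis
    unfolding eventually_tails
    by (intro exI [of _ N] allI impI) (auto intro!: N)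
qed

lemma eventually_tails_nonempty:
  assumes "eventually Q tails"
  obtains \<alpha> where "finite \<alpha>" "\<alpha> \<noteq> {}" "Q \<alpha>"
proof -
  from assms obtain N where "\<And>\<alpha>. finite \<alpha> \<Longrightarrow> \<alpha> \<subseteq> {N..} \<Longrightarrow> Q \<alpha>"
    by (auto simp: eventually_tails)
  then show ?thesis by (intro that [of "{N}"]) auto
qed

section \<open>Polynomial maps adapted to a filtration\<close>

text \<open>The first \<open>D\<close> levels are the whole group, so a map of degree d \<le> D can
  start at level D - d: each derivative lowers the degree and raises the level by one.\<close>

locale filtered_group = group G for G :: "('a, 'b) monoid_scheme" (structure) +
  fixes H :: "nat \<Rightarrow> 'a set" and D :: nat
  assumes H_subgroup: "subgroup (H j) G"
    and H_Suc_subset: "H (Suc j) \<subseteq> H j"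
    and H_commutator: "\<lbrakk>x \<in> H i; y \<in> H j\<rbrakk> \<Longrightarrow> commutator G x y \<in> H (i + j)"
    and H_carrier: "j \<le> D \<Longrightarrow> H j = carrier G"
    and D_pos: "1 \<le> D"
begin

text \<open>
  Closing the generators under commutators from the outset, instead of defining polynomial maps
  by the vanishing of iterated differences, makes stability under differences a
  rule induction (lemma \<open>poly_difference\<close>) with no circularity between products and commutators.
\<close>

inductive poly :: "nat \<Rightarrow> (nat set \<Rightarrow> 'a) \<Rightarrow> bool" where
  base: "\<lbrakk>\<And>\<alpha>. Q \<alpha> \<in> carrier G; Q {} = \<one>; polynomial_of_degree G d (restrict Q FN); d + j \<le> D\<rbrakk>
    \<Longrightarrow> poly j Q"
| const: "g \<in> H j \<Longrightarrow> poly j (\<lambda>_. g)"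
| mult: "\<lbrakk>poly j Q; poly j R\<rbrakk> \<Longrightarrow> poly j (\<lambda>\<alpha>. Q \<alpha> \<otimes> R \<alpha>)"
| inverse: "poly j Q \<Longrightarrow> poly j (\<lambda>\<alpha>. inv (Q \<alpha>))"
| comm: "\<lbrakk>poly i Q; poly j R\<rbrakk> \<Longrightarrow> poly (i + j) (\<lambda>\<alpha>. commutator G (Q \<alpha>) (R \<alpha>))"
| Suc_mono: "poly (Suc j) Q \<Longrightarrow> poly j Q"
| cong_ae: "\<lbrakk>poly j Q; eventually (\<lambda>\<alpha>. Q \<alpha> = R \<alpha>) tails; \<And>\<alpha>. R \<alpha> \<in> carrier G\<rbrakk> \<Longrightarrow> poly j R"

lemma H_in_carrier: "x \<in> H j \<Longrightarrow> x \<in> carrier G"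
  using H_subgroup subgroup.subset by blast

lemma poly_closed: "poly j Q \<Longrightarrow> Q \<alpha> \<in> carrier G"
  by (induction arbitrary: \<alpha> rule: poly.induct) (auto dest: H_in_carrier)

lemma poly_antimono: "\<lbrakk>poly j Q; i \<le> j\<rbrakk> \<Longrightarrow> poly i Q"
  by (rule inc_induct [of i j "\<lambda>i. poly i Q"]) (auto intro: Suc_mono)

lemma poly_eq: "\<lbrakk>poly j Q; \<And>\<alpha>. R \<alpha> = Q \<alpha>\<rbrakk> \<Longrightarrow> poly j R"
  by (rule cong_ae) (auto simp: poly_closed)

text \<open>Ties the level of a map to its values: where the filtration has become trivial, a map of
  that level is almost everywhere \<open>\<one>\<close>.\<close>

lemma poly_values: "poly j Q \<Longrightarrow> eventually (\<lambda>\<alpha>. Q \<alpha> \<in> H j) tails"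
proof (induction rule: poly.induct)
  case (base Q d j)
  then show ?case by (simp add: H_carrier)
next
  case (const g j)
  then show ?case by simp
next
  case (mult j Q R)
  from mult.IH show ?case
    by eventually_elim (simp add: H_subgroup subgroup.m_closed)
next
  case (inverse j Q)
  from inverse.IH show ?case
    by eventually_elim (simp add: H_subgroup subgroup.m_inv_closed)
next
  case (comm i Q j R)
  from comm.IH show ?case
    by eventually_elim (rule H_commutator)
next
  case (Suc_mono j Q)
  from Suc_mono.IH show ?case
    by eventually_elim (use H_Suc_subset in blast)
next
  case (cong_ae j Q R)
  from cong_ae.IH cong_ae.hyps(2) show ?case
    by eventually_elim simp
qed

lemma poly_conjugate:
  assumes "poly j Q" "poly i R"
  shows "poly j (\<lambda>\<alpha>. conjugate G (Q \<alpha>) (R \<alpha>))"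
proof -
  have "poly j (\<lambda>\<alpha>. commutator G (Q \<alpha>) (R \<alpha>))"
    by (rule poly_antimono [OF poly.comm [OF assms]]) simp
  from poly.mult [OF assms(1) this] show ?thesis
    by (rule poly_eq) (use assms in \<open>simp add: poly_closed conjugate_eq_mult_commutator\<close>)
qed

text \<open>In degree 1 the difference is the constant \<open>Q \<beta>\<close> conjugated by
  \<open>Q\<close>; in higher degree it is the derivative, of smaller degree, times the constant
  \<open>Q \<beta>\<close>.\<close>

lemma poly_difference_base:
  assumes Q: "\<And>\<alpha>. Q \<alpha> \<in> carrier G" "Q {} = \<one>"
    and deg: "polynomial_of_degree G d (restrict Q FN)" "d + j \<le> D"
  shows "eventually (\<lambda>\<beta>. poly (Suc j) (\<lambda>\<alpha>. inv (Q \<alpha>) \<otimes> Q (\<alpha> \<union> \<beta>))) tails"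
proof -
  have d: "d \<noteq> 0" using deg(1) by (cases d) auto
  \<comment> \<open>Since \<open>d\<close> is at least 1, level \<open>Suc j\<close> is still among
    the first \<open>D\<close>, so every constant is available there.\<close>
  then have Hc: "H (Suc j) = carrier G"
    using deg(2) by (intro H_carrier) simp
  have triv: "poly (Suc j) (\<lambda>\<alpha>. inv (Q \<alpha>) \<otimes> Q (\<alpha> \<union> {}))"
    by (rule poly_eq [OF const [of \<one>]]) (simp_all add: Q Hc)
  consider "d = Suc 0" | e where "d = Suc (Suc e)"
    using d by (metis not0_implies_Suc)
  then show ?thesis
  proof cases
    case 1
    then obtain x where x: "ip_mapping G x" "eq_ae (restrict Q FN) x"
      using deg(1) by auto
    have "eventually (\<lambda>\<alpha>. \<alpha> \<noteq> {} \<longrightarrow> \<alpha> \<in> {\<alpha>\<in>FN. restrict Q FN \<alpha> = x \<alpha>}) tails"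
      using x(2) by (intro EE_eventually_tails) (simp add: eq_ae_def)
    then have *: "eventually (\<lambda>\<alpha>. \<alpha> \<noteq> {} \<longrightarrow> \<alpha> \<in> FN \<and> Q \<alpha> = x \<alpha>) tails"
      by eventually_elim auto
    have "poly (Suc j) (\<lambda>\<alpha>. inv (Q \<alpha>) \<otimes> Q (\<alpha> \<union> \<beta>))"
      if \<beta>: "finite \<beta>" "\<beta> \<noteq> {} \<longrightarrow> \<beta> \<in> FN \<and> Q \<beta> = x \<beta>"
        and \<beta>u: "eventually (\<lambda>\<alpha>. \<alpha> \<union> \<beta> \<noteq> {} \<longrightarrow> \<alpha> \<union> \<beta> \<in> FN \<and> Q (\<alpha> \<union> \<beta>) = x (\<alpha> \<union> \<beta>)) tails" for \<beta>
    proof (cases "\<beta> = {}")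
      case True
      with triv show ?thesis by simp
    next
      case False
      have Qj: "poly j Q" by (rule base [OF Q deg])
      have g: "poly (Suc j) (\<lambda>_. Q \<beta>)" by (rule const) (simp add: Hc Q)
      show ?thesis
      proof (rule cong_ae [OF poly_conjugate [OF g Qj]])
        from * \<beta>u eventually_tails_greater [OF \<beta>(1) False]
        show "eventually (\<lambda>\<alpha>. conjugate G (Q \<beta>) (Q \<alpha>) = inv (Q \<alpha>) \<otimes> Q (\<alpha> \<union> \<beta>)) tails"
        proof eventually_elim
          case (elim \<alpha>)
          show ?case
          proof (cases "\<alpha> = {}")
            case True
            \<comment> \<open>The empty set belongs to every tail; there both sides reduce to
              \<open>Q \<beta>\<close> because \<open>Q {} = \<one>\<close>.\<close>
            then show ?thesis by (simp add: Q conjugate_def)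
          next
            case False
            with elim \<beta> \<open>\<beta> \<noteq> {}\<close> have "\<alpha> \<in> FN" "\<beta> \<in> FN" "fin_less \<beta> \<alpha>" by auto
            then have "x (\<beta> \<union> \<alpha>) = x \<beta> \<otimes> x \<alpha>"
              using x(1) by (simp add: ip_mapping_def)
            then have "Q (\<alpha> \<union> \<beta>) = Q \<beta> \<otimes> Q \<alpha>"
              using elim \<beta> False \<open>\<beta> \<noteq> {}\<close> by (simp add: Un_commute)
            then show ?thesis by (simp add: conjugate_def m_assoc Q)
          qed
        qed
      qed (simp add: Q)
    qed
    note poly_diff = this
    from eventually_tails_finite * eventually_tails_union [OF *] show ?thesis
      by eventually_elim (rule poly_diff)
  next
    case (2 e)
    then have "{\<beta>\<in>FN. polynomial_of_degree G (Suc e) (derivative G \<beta> (restrict Q FN))} \<in> EE"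
      using deg(1) by simp
    from EE_eventually_tails [OF this] show ?thesis
    proof eventually_elim
      case (elim \<beta>)
      show ?case
      proof (cases "\<beta> = {}")
        case True
        with triv show ?thesis by simp
      next
        case False
        let ?R = "\<lambda>\<alpha>. inv (Q \<alpha>) \<otimes> Q (\<alpha> \<union> \<beta>) \<otimes> inv (Q \<beta>)"
        from False elim have \<beta>: "\<beta> \<in> FN"
          and pd: "polynomial_of_degree G (Suc e) (derivative G \<beta> (restrict Q FN))" by auto
        have "derivative G \<beta> (restrict Q FN) = restrict ?R FN"
          using \<beta> by (auto simp: derivative_def FN_def)
        with pd have "poly (Suc j) ?R"
          by (intro base [of _ "Suc e"]) (use 2 deg Q in auto)
        from poly.mult [OF this const [of "Q \<beta>"]] show ?thesis
          by (rule poly_eq) (simp_all add: Q Hc m_assoc)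
      qed
    qed
  qed
qed

text \<open>For each constructor a group identity expresses the difference through the differences
  of the arguments, up to conjugations, which preserve the level.\<close>

lemma poly_difference:
  "poly j Q \<Longrightarrow> eventually (\<lambda>\<beta>. poly (Suc j) (\<lambda>\<alpha>. inv (Q \<alpha>) \<otimes> Q (\<alpha> \<union> \<beta>))) tails"
proof (induction rule: poly.induct)
  case (base Q d j)
  then show ?case by (rule poly_difference_base)
next
  case (const g j)
  have "poly (Suc j) (\<lambda>_. inv g \<otimes> g)"
    by (rule poly_eq [OF poly.const [of \<one>]])
      (use const in \<open>simp_all add: H_in_carrier H_subgroup subgroup.one_closed\<close>)
  then show ?case by simp
next
  case (mult j Q R)
  note [simp] = poly_closed [OF mult.hyps(1)] poly_closed [OF mult.hyps(2)]
  from mult.IH show ?case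
  proof eventually_elim
    case (elim \<beta>)
    show ?case
      by (rule poly_eq [OF poly.mult [OF poly_conjugate [OF elim(1) mult.hyps(2)] elim(2)]])
        (simp add: word_simps)
  qed
next
  case (inverse j Q)
  note [simp] = poly_closed [OF inverse.hyps]
  from inverse.IH show ?case
  proof eventually_elim
    case (elim \<beta>)
    show ?case
      by (rule poly_eq [OF poly_conjugate [OF poly.inverse [OF elim] poly.inverse [OF inverse.hyps]]])
        (simp add: word_simps)
  qed
next
  case (comm i Q j R)
  note [simp] = poly_closed [OF comm.hyps(1)] poly_closed [OF comm.hyps(2)]
  from comm.IH show ?case
  proof eventually_elim
    case (elim \<beta>)
    let ?U = "\<lambda>\<alpha>. inv (Q \<alpha>) \<otimes> Q (\<alpha> \<union> \<beta>)" and ?V = "\<lambda>\<alpha>. inv (R \<alpha>) \<otimes> R (\<alpha> \<union> \<beta>)"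
    let ?c = "\<lambda>x y \<alpha>. commutator G (x \<alpha>) (y \<alpha>)"
    note QR = poly.comm [OF comm.hyps]
    have R': "poly j (\<lambda>\<alpha>. R \<alpha> \<otimes> ?V \<alpha>)"
      by (rule poly.mult [OF comm.hyps(2) Suc_mono [OF elim(2)]])
    \<comment> \<open>Expanding [Q U, R V] and dividing by [Q, R] leaves the factors [Q, V]^[Q, R],
      [[Q, R], V], [[Q, R V], U] and [U, R V]. Each involves a difference, hence has level at least
      i + j + 1.\<close>
    have 1: "poly (Suc (i + j)) (\<lambda>\<alpha>. conjugate G (?c Q ?V \<alpha>) (?c Q R \<alpha>))"
      using poly_conjugate [OF poly.comm [OF comm.hyps(1) elim(2)] QR] by simp
    have 2: "poly (Suc (i + j)) (?c (?c Q R) ?V)"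
      by (rule poly_antimono [OF poly.comm [OF QR elim(2)]]) simp
    have 3: "poly (Suc (i + j)) (?c (?c Q (\<lambda>\<alpha>. R \<alpha> \<otimes> ?V \<alpha>)) ?U)"
      by (rule poly_antimono [OF poly.comm [OF poly.comm [OF comm.hyps(1) R'] elim(1)]]) simp
    have 4: "poly (Suc (i + j)) (?c ?U (\<lambda>\<alpha>. R \<alpha> \<otimes> ?V \<alpha>))"
      using poly.comm [OF elim(1) R'] by simp
    show ?case
      by (rule poly_eq [OF poly.mult [OF poly.mult [OF poly.mult [OF 1 2] 3] 4]])
        (simp add: word_simps)
  qed
next
  case (Suc_mono j Q)
  from Suc_mono.IH show ?case
    by eventually_elim (rule poly.Suc_mono)
next
  case (cong_ae j Q R)
  from cong_ae.IH eventually_tails_union [OF cong_ae.hyps(2)] show ?case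
  proof eventually_elim
    case (elim \<beta>)
    show ?case
    proof (rule poly.cong_ae [OF elim(1)])
      from elim(2) cong_ae.hyps(2)
      show "eventually (\<lambda>\<alpha>. inv (Q \<alpha>) \<otimes> Q (\<alpha> \<union> \<beta>) = inv (R \<alpha>) \<otimes> R (\<alpha> \<union> \<beta>)) tails"
        by eventually_elim simp
    qed (simp add: cong_ae.hyps(3))
  qed
qed

end

text \<open>Each term of the series is repeated \<open>D\<close> times from level 1 on, so that
  levels 1 to \<open>D\<close> are the whole group and level n D + 1 is term n.\<close>

lemma (in group) filtered_group_lower_central_series:
  assumes "1 \<le> D"
  shows "filtered_group G (\<lambda>j. lower_central_series G ((j - 1) div D)) D"
proof (intro filtered_group.intro filtered_group_axioms.intro group_axioms)
  fix i j x y
  show "subgroup (lower_central_series G ((j - 1) div D)) G"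
    by (rule lower_central_series_subgroup)
  show "lower_central_series G ((Suc j - 1) div D) \<subseteq> lower_central_series G ((j - 1) div D)"
    by (intro lower_central_series_antimono div_le_mono) simp
  show "1 \<le> D" by (rule assms)
  show "lower_central_series G ((j - 1) div D) = carrier G" if "j \<le> D"
  proof -
    have "(j - 1) div D = 0" using that assms by (intro div_less) simp
    then show ?thesis by simp
  qed
  assume x: "x \<in> lower_central_series G ((i - 1) div D)" and y: "y \<in> lower_central_series G ((j - 1) div D)"
  have xc: "x \<in> carrier G" and yc: "y \<in> carrier G"
    using x y lower_central_series_carrier by blast+
  let ?a = "(i - 1) div D" and ?b = "(j - 1) div D"
  \<comment> \<open>By truncated subtraction level 0 coincides with level 1 and escapes the
    arithmetic below; there closure under commutators with the whole group suffices.\<close>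
  consider "i = 0" | "j = 0" | "0 < i" "0 < j" by blast
  then show "commutator G x y \<in> lower_central_series G ((i + j - 1) div D)"
  proof cases
    case 1
    have "commutator G y x \<in> lower_central_series G (Suc ?b)"
      by (rule commutator_in_lower_central_series [OF y xc])
    then have "commutator G y x \<in> lower_central_series G ?b"
      using lower_central_series_Suc_subset by blast
    then have "inv (commutator G y x) \<in> lower_central_series G ?b"
      by (rule subgroup.m_inv_closed [OF lower_central_series_subgroup])
    with 1 commutator_swap [OF xc yc] show ?thesis by simp
  next
    case 2
    have "commutator G x y \<in> lower_central_series G (Suc ?a)"
      by (rule commutator_in_lower_central_series [OF x yc])
    with 2 show ?thesis using lower_central_series_Suc_subset by auto
  next
    case 3
    \<comment> \<open>What is lost by rounding down twice is compensated by the extra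
      \<open>Suc\<close> in \<open>lower_central_series_commutator\<close>.\<close>
    have "i - 1 < Suc ?a * D" "j - 1 < Suc ?b * D"
      using assms dividend_less_div_times [of D "i - 1"] dividend_less_div_times [of D "j - 1"]
      by simp_all
    then have "i + j - 1 < (Suc (Suc (?a + ?b))) * D"
      using 3 by (simp add: algebra_simps)
    then have "(i + j - 1) div D < Suc (Suc (?a + ?b))"
      by (rule less_mult_imp_div_less)
    then have "(i + j - 1) div D \<le> Suc (?a + ?b)" by simp
    with lower_central_series_commutator [OF x y] lower_central_series_antimono show ?thesis by blast
  qed
qed

section \<open>Weights of systems of polynomial maps\<close>

text \<open>Lexicographic descent: either one of the first \<open>L\<close> coordinates drops
  suitably, or they all stay equal and the new last one drops. Coordinates above the drop are
  unrestricted because division by a map of level j may create new terms there.\<close>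

lemma wf_weight_order:
  fixes L :: nat
  shows "wf {(f, g). \<exists>j<L. f j < (g j :: nat) \<and> (\<forall>i<j. f i \<le> g i)}" (is "wf (?R L)")
proof (induction L)
  case 0
  then show ?case by simp
next
  case (Suc L)
  let ?S = "inv_image (?R L <*lex*> less_than) (\<lambda>f. (restrict f {..<L}, f L))"
  have "?R (Suc L) \<subseteq> ?S"
  proof clarify
    fix f g :: "nat \<Rightarrow> nat" and j
    assume j: "j < Suc L" "f j < g j" "\<forall>i<j. f i \<le> g i"
    show "(f, g) \<in> ?S"
    proof (cases "\<exists>i<L. f i < g i \<and> (\<forall>k<i. f k \<le> g k)")
      case True
      then show ?thesis by fastforce
    next
      case False
      with j have "j = L" by (metis less_SucE)
      with False j have "\<forall>i<L. f i = g i"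
        by (metis le_neq_implies_less less_trans)
      then have "restrict f {..<L} = restrict g {..<L}"
        by (auto simp: restrict_def)
      with j \<open>j = L\<close> show ?thesis by simp
    qed
  qed
  moreover have "wf ?S"
    by (intro wf_inv_image wf_lex_prod Suc wf_less_than)
  ultimately show ?case
    by (rule wf_subset [rotated])
qed

section \<open>Congruence modulo a level, and leading terms\<close>

context filtered_group
begin

definition pcong :: "nat \<Rightarrow> (nat set \<Rightarrow> 'a) \<Rightarrow> (nat set \<Rightarrow> 'a) \<Rightarrow> bool" where
  "pcong j Q R \<longleftrightarrow> (\<forall>\<alpha>. Q \<alpha> \<in> carrier G) \<and> (\<forall>\<alpha>. R \<alpha> \<in> carrier G) \<and>
     poly j (\<lambda>\<alpha>. inv (Q \<alpha>) \<otimes> R \<alpha>)"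

lemma pcongI:
  "\<lbrakk>\<And>\<alpha>. Q \<alpha> \<in> carrier G; \<And>\<alpha>. R \<alpha> \<in> carrier G; poly j S;
    \<And>\<alpha>. inv (Q \<alpha>) \<otimes> R \<alpha> = S \<alpha>\<rbrakk> \<Longrightarrow> pcong j Q R"
  by (simp add: pcong_def)

lemma pcong_closed: "pcong j Q R \<Longrightarrow> Q \<alpha> \<in> carrier G" "pcong j Q R \<Longrightarrow> R \<alpha> \<in> carrier G"
  by (simp_all add: pcong_def)

lemma pcong_poly: "pcong j Q R \<Longrightarrow> poly j (\<lambda>\<alpha>. inv (Q \<alpha>) \<otimes> R \<alpha>)"
  by (simp add: pcong_def)

lemma pcong_antimono: "\<lbrakk>pcong j Q R; i \<le> j\<rbrakk> \<Longrightarrow> pcong i Q R"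
  by (auto simp: pcong_def intro: poly_antimono)

lemma poly_one: "poly j (\<lambda>_. \<one>)"
  by (rule const) (simp add: H_subgroup subgroup.one_closed)

lemma pcong_refl: "(\<And>\<alpha>. Q \<alpha> \<in> carrier G) \<Longrightarrow> pcong j Q Q"
  by (rule pcongI [OF _ _ poly_one]) auto

lemma pcong_sym: "pcong j Q R \<Longrightarrow> pcong j R Q"
  by (rule pcongI [OF _ _ poly.inverse [OF pcong_poly]])
    (auto simp: pcong_closed inv_mult_group)

lemma pcong_trans:
  assumes "pcong j Q R" "pcong j R S"
  shows "pcong j Q S"
  by (rule pcongI [OF _ _ poly.mult [OF pcong_poly [OF assms(1)] pcong_poly [OF assms(2)]]])
    (simp_all add: pcong_closed [OF assms(1)] pcong_closed [OF assms(2)] m_assoc)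

text \<open>The quotient of the products is (Q^-1 Q')^R R^-1 R'; with \<open>poly 0 R\<close> the
  conjugation preserves the level.\<close>

lemma pcong_mult:
  assumes "pcong j Q Q'" "pcong j R R'" "poly 0 R"
  shows "pcong j (\<lambda>\<alpha>. Q \<alpha> \<otimes> R \<alpha>) (\<lambda>\<alpha>. Q' \<alpha> \<otimes> R' \<alpha>)"
  by (rule pcongI [OF _ _ poly.mult [OF poly_conjugate [OF pcong_poly [OF assms(1)] assms(3)]
            pcong_poly [OF assms(2)]]])
    (simp_all add: pcong_closed [OF assms(1)] pcong_closed [OF assms(2)] word_simps)

lemma pcong_inv:
  assumes "pcong j Q Q'" "poly 0 Q"
  shows "pcong j (\<lambda>\<alpha>. inv (Q \<alpha>)) (\<lambda>\<alpha>. inv (Q' \<alpha>))"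
  by (rule pcongI [OF _ _ poly_conjugate [OF poly.inverse [OF pcong_poly [OF assms(1)]]
            poly.inverse [OF assms(2)]]])
    (simp_all add: pcong_closed [OF assms(1)] word_simps)

text \<open>Since \<open>1 \<le> D\<close>, a constant has level 1 and a commutator with it gains
  one level, so leading terms do not see conjugation by constants.\<close>

lemma pcong_conjugate:
  assumes "poly j Q" "k \<in> carrier G"
  shows "pcong (Suc j) Q (\<lambda>\<alpha>. conjugate G (Q \<alpha>) k)"
proof -
  have "poly 1 (\<lambda>_. k)"
    by (rule const) (use assms D_pos in \<open>simp add: H_carrier\<close>)
  from poly.comm [OF assms(1) this] have "poly (Suc j) (\<lambda>\<alpha>. commutator G (Q \<alpha>) k)"
    by simp
  then show ?thesis
    by (rule pcongI [rotated 2]) (use assms in \<open>simp_all add: poly_closed word_simps\<close>)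
qed

lemma poly_pcong: "\<lbrakk>poly j Q; pcong j Q R\<rbrakk> \<Longrightarrow> poly j R"
  by (rule poly_eq [OF poly.mult [OF _ pcong_poly]]) (auto simp: pcong_closed)

lemma pcong_one: "poly j Q \<Longrightarrow> pcong j (\<lambda>_. \<one>) Q"
  by (rule pcongI [of _ _ _ Q]) (auto simp: poly_closed)

definition shift :: "nat set \<Rightarrow> (nat set \<Rightarrow> 'a) \<Rightarrow> nat set \<Rightarrow> 'a" where
  "shift \<beta> Q = (\<lambda>\<alpha>. inv (Q \<beta>) \<otimes> Q (\<alpha> \<union> \<beta>))"

lemma pcong_shift:
  assumes "poly j Q" "Q {} = \<one>"
  shows "eventually (\<lambda>\<beta>. pcong (Suc j) Q (shift \<beta> Q)) tails"
  using poly_difference [OF assms(1)]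
proof eventually_elim
  case (elim \<beta>)
  note [simp] = poly_closed [OF assms(1)]
  \<comment> \<open>Evaluated at the empty set the difference is \<open>Q \<beta>\<close>, so the
    normalising constant of \<open>shift\<close> has level \<open>Suc j\<close> too.\<close>
  have "inv (Q {}) \<otimes> Q ({} \<union> \<beta>) \<in> H (Suc j)"
    by (rule eventually_tails_empty [OF poly_values [OF elim]])
  then have "inv (Q \<beta>) \<in> H (Suc j)"
    using assms(2) by (simp add: H_subgroup subgroup.m_inv_closed)
  from poly.mult [OF poly_conjugate [OF const [OF this] assms(1)] elim]
  show ?case
    by (rule pcongI [rotated 2]) (simp_all add: shift_def word_simps)
qed

definition pclass :: "nat \<Rightarrow> (nat set \<Rightarrow> 'a) \<Rightarrow> (nat set \<Rightarrow> 'a) set" where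
  "pclass j Q = {R. pcong (Suc j) Q R}"

definition of_level :: "nat \<Rightarrow> (nat set \<Rightarrow> 'a) \<Rightarrow> bool" where
  "of_level j Q \<longleftrightarrow> poly j Q \<and> \<not> poly (Suc j) Q"

definition weight :: "(nat set \<Rightarrow> 'a) set \<Rightarrow> nat \<Rightarrow> nat" where
  "weight \<Q> j = card (pclass j ` {Q\<in>\<Q>. of_level j Q})"

lemma pclass_eq: "pcong (Suc j) Q R \<Longrightarrow> pclass j Q = pclass j R"
  by (auto simp: pclass_def intro: pcong_trans pcong_sym)

lemma ex_level:
  assumes "poly 0 Q" "\<not> poly L Q"
  obtains j where "j < L" "of_level j Q"
proof -
  have "\<exists>j<L. poly j Q \<and> \<not> poly (Suc j) Q"
    using assms by (induction L) (auto simp: less_Suc_eq)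
  then show ?thesis using that by (auto simp: of_level_def)
qed

text \<open>The class of the quotient depends on \<open>Q\<close> only through its class, so
  dividing by \<open>S\<close> cannot increase the number of classes.\<close>

lemma pclass_div:
  assumes "poly 0 Q" "poly 0 S"
  shows "pclass j (\<lambda>\<alpha>. Q \<alpha> \<otimes> inv (S \<alpha>)) =
    {R. (\<forall>\<alpha>. R \<alpha> \<in> carrier G) \<and> (\<lambda>\<alpha>. R \<alpha> \<otimes> S \<alpha>) \<in> pclass j Q}" (is "?A = ?B")
proof (intro equalityI subsetI)
  fix R assume "R \<in> ?A"
  then have R: "pcong (Suc j) (\<lambda>\<alpha>. Q \<alpha> \<otimes> inv (S \<alpha>)) R"
    by (simp add: pclass_def)
  have S: "pcong (Suc j) S S" by (rule pcong_refl) (simp add: poly_closed [OF assms(2)])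
  from pcong_mult [OF R S assms(2)]
  have "pcong (Suc j) Q (\<lambda>\<alpha>. R \<alpha> \<otimes> S \<alpha>)"
    by (simp add: m_assoc poly_closed [OF assms(1)] poly_closed [OF assms(2)])
  with R show "R \<in> ?B" by (simp add: pclass_def pcong_closed)
next
  fix R assume R: "R \<in> ?B"
  then have 1: "pcong (Suc j) Q (\<lambda>\<alpha>. R \<alpha> \<otimes> S \<alpha>)"
    by (simp add: pclass_def)
  have "pcong (Suc j) (\<lambda>\<alpha>. inv (S \<alpha>)) (\<lambda>\<alpha>. inv (S \<alpha>))"
    by (rule pcong_refl) (simp add: poly_closed [OF assms(2)])
  from pcong_mult [OF 1 this poly.inverse [OF assms(2)]] R show "R \<in> ?A"
    by (simp add: pclass_def m_assoc poly_closed [OF assms(2)])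
qed

text \<open>
  The weight of a system drops when every map is divided by a map \<open>S\<close> of the deepest
  occurring level \<open>j\<close>: the class of \<open>S\<close> disappears from level \<open>j\<close>, and lower levels do not see \<open>S\<close>.
\<close>

lemma weight_decrease:
  assumes fin: "finite \<Q>" and poly0: "\<And>Q. Q \<in> \<Q> \<Longrightarrow> poly 0 Q"
    and S: "S \<in> \<Q>" "of_level j S"
    and deepest: "\<And>Q. \<lbrakk>Q \<in> \<Q>; poly (Suc j) Q\<rbrakk> \<Longrightarrow> poly L Q"
    and \<Q>': "\<And>Q'. Q' \<in> \<Q>' \<Longrightarrow> \<exists>Q\<in>\<Q>. \<not> poly L Q \<and>
      (\<forall>i\<le>j. poly i Q \<longrightarrow> pcong (Suc i) (\<lambda>\<alpha>. Q \<alpha> \<otimes> inv (S \<alpha>)) Q')"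
  shows "weight \<Q>' j < weight \<Q> j" and "\<And>i. i < j \<Longrightarrow> weight \<Q>' i \<le> weight \<Q> i"
proof -
  note S0 = poly0 [OF S(1)]
  have Sj: "poly j S" using S(2) by (simp add: of_level_def)
  \<comment> \<open>A new map of level at most \<open>j\<close> comes from an old map of the same
    level: below \<open>j\<close> the divisor \<open>S\<close> is invisible, being one level deeper,
    and at \<open>j\<close> the hypothesis \<open>deepest\<close> excludes old maps of deeper
    level.\<close>
  have origin: "\<exists>Q\<in>\<Q>. of_level i Q \<and> pcong (Suc i) (\<lambda>\<alpha>. Q \<alpha> \<otimes> inv (S \<alpha>)) Q'
      \<and> (i < j \<longrightarrow> pcong (Suc i) Q Q')"
    if Q': "Q' \<in> \<Q>'" and lev: "of_level i Q'" and i: "i \<le> j" for Q' i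
  proof -
    from \<Q>' [OF Q'] obtain Q where Q: "Q \<in> \<Q>" "\<not> poly L Q"
      and cong: "\<And>i. \<lbrakk>i \<le> j; poly i Q\<rbrakk> \<Longrightarrow> pcong (Suc i) (\<lambda>\<alpha>. Q \<alpha> \<otimes> inv (S \<alpha>)) Q'"
      by blast
    have Q0: "poly 0 Q" by (rule poly0 [OF Q(1)])
    obtain l where l: "l < L" "of_level l Q"
      using ex_level [OF Q0 Q(2)] .
    have below: "pcong (Suc i) Q Q'" if "i < j" "poly i Q" for i
    proof -
      have "poly (Suc i) S" using poly_antimono [OF Sj] that by simp
      then have "poly (Suc i) (\<lambda>\<alpha>. inv (S \<alpha>))" by (rule poly.inverse)
      from pcong_mult [OF pcong_refl pcong_one [OF this] poly_one, of Q]
      have "pcong (Suc i) Q (\<lambda>\<alpha>. Q \<alpha> \<otimes> inv (S \<alpha>))"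
        by (simp add: poly_closed [OF Q0])
      from pcong_trans [OF this cong] that show ?thesis by simp
    qed
    have "\<not> l < i"
    proof
      assume "l < i"
      then have "pcong (Suc l) Q Q'" "poly (Suc l) Q'"
        using below [of l] l(2) i lev by (auto simp: of_level_def intro: poly_antimono)
      then have "poly (Suc l) Q" by (blast intro: poly_pcong pcong_sym)
      with l(2) show False by (simp add: of_level_def)
    qed
    then have Qi: "poly i Q" using l(2) by (auto simp: of_level_def intro: poly_antimono)
    have "\<not> poly (Suc i) Q"
    proof
      assume Si: "poly (Suc i) Q"
      show False
      proof (cases "i < j")
        case True
        with below Qi Si have "poly (Suc i) Q'" by (blast intro: poly_pcong)
        with lev show False by (simp add: of_level_def)
      next
        case False
        with i Si deepest Q show False by simp
      qed
    qed
    with Qi Q cong [OF i Qi] below show ?thesis by (auto simp: of_level_def)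
  qed
  let ?C = "pclass j ` {Q\<in>\<Q>. of_level j Q}"
  let ?f = "\<lambda>X. {R. (\<forall>\<alpha>. R \<alpha> \<in> carrier G) \<and> (\<lambda>\<alpha>. R \<alpha> \<otimes> S \<alpha>) \<in> X}"
  \<comment> \<open>An old map in the class of \<open>S\<close> would give a quotient of level
    \<open>Suc j\<close>, which is not counted at level \<open>j\<close>; so one class is
    lost.\<close>
  have "pclass j ` {Q\<in>\<Q>'. of_level j Q} \<subseteq> ?f ` (?C - {pclass j S})"
  proof clarify
    fix Q' assume Q': "Q' \<in> \<Q>'" "of_level j Q'"
    from origin [OF Q'] obtain Q where Q: "Q \<in> \<Q>" "of_level j Q"
      and cong: "pcong (Suc j) (\<lambda>\<alpha>. Q \<alpha> \<otimes> inv (S \<alpha>)) Q'" by auto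
    have "pclass j Q' = ?f (pclass j Q)"
      using pclass_eq [OF cong] pclass_div [OF poly0 [OF Q(1)] S0] by simp
    moreover have "pclass j Q \<noteq> pclass j S"
    proof
      assume "pclass j Q = pclass j S"
      moreover have "Q \<in> pclass j Q"
        by (simp add: pclass_def pcong_refl poly_closed [OF poly0 [OF Q(1)]])
      ultimately have "pcong (Suc j) S Q" by (simp add: pclass_def)
      moreover have "pcong (Suc j) (\<lambda>\<alpha>. inv (S \<alpha>)) (\<lambda>\<alpha>. inv (S \<alpha>))"
        by (rule pcong_refl) (simp add: poly_closed [OF S0])
      ultimately have "pcong (Suc j) (\<lambda>_. \<one>) (\<lambda>\<alpha>. Q \<alpha> \<otimes> inv (S \<alpha>))"
        using pcong_mult [OF _ _ poly.inverse [OF S0], of "Suc j" S Q]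
        by (simp add: poly_closed [OF S0])
      then have "poly (Suc j) Q'"
        using cong poly_one by (blast intro: poly_pcong)
      with Q' show False by (simp add: of_level_def)
    qed
    ultimately show "pclass j Q' \<in> ?f ` (?C - {pclass j S})"
      using Q by blast
  qed
  then have "weight \<Q>' j \<le> card (?C - {pclass j S})"
    unfolding weight_def using fin by (intro surj_card_le) auto
  also have "\<dots> < card ?C"
    using fin S by (intro card_Diff1_less) auto
  finally show "weight \<Q>' j < weight \<Q> j" by (simp add: weight_def)
  fix i assume "i < j"
  have "pclass i ` {Q\<in>\<Q>'. of_level i Q} \<subseteq> pclass i ` {Q\<in>\<Q>. of_level i Q}"
  proof clarify
    fix Q' assume "Q' \<in> \<Q>'" "of_level i Q'"
    from origin [OF this] \<open>i < j\<close> obtain Q where "Q \<in> \<Q>" "of_level i Q" "pcong (Suc i) Q Q'"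
      by auto
    then show "pclass i Q' \<in> pclass i ` {Q\<in>\<Q>. of_level i Q}"
      using pclass_eq by blast
  qed
  then show "weight \<Q>' i \<le> weight \<Q> i"
    unfolding weight_def using fin by (intro card_mono) auto
qed

lemma eventually_pcong_shift:
  assumes "Q {} = \<one>"
  shows "eventually (\<lambda>\<beta>. \<forall>i\<in>{..j}. poly i Q \<longrightarrow> pcong (Suc i) Q (shift \<beta> Q)) tails"
  by (rule eventually_ball_finite) (auto intro: eventually_mono [OF pcong_shift] assms)

text \<open>The map on the right is the shape of the quotients in the new system of colour focusing.
  Shifts and conjugations by constants change only deeper terms.\<close>

lemma pcong_new_system:
  assumes poly: "poly i Q" "poly i S"
    and shift: "pcong (Suc i) Q (shift \<beta> Q)" "pcong (Suc i) S (shift \<beta>' S)"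
    and carr: "k \<in> carrier G" "k' \<in> carrier G" "h \<in> carrier G"
  shows "pcong (Suc i) (\<lambda>\<alpha>. Q \<alpha> \<otimes> inv (S \<alpha>))
    (\<lambda>\<alpha>. conjugate G (conjugate G (shift \<beta> Q \<alpha>) k \<otimes> inv (conjugate G (shift \<beta>' S \<alpha>) k')) h)"
proof -
  have conj: "pcong (Suc i) R (\<lambda>\<alpha>. conjugate G (shift \<gamma> R \<alpha>) l)"
    if "poly i R" "pcong (Suc i) R (shift \<gamma> R)" "l \<in> carrier G" for R \<gamma> l
  proof -
    have "poly i (shift \<gamma> R)"
      using that by (blast intro: poly_pcong pcong_antimono le_SucI)
    from pcong_trans [OF that(2) pcong_conjugate [OF this that(3)]] show ?thesis .
  qed
  have S0: "poly 0 S" by (rule poly_antimono [OF poly(2)]) simp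
  from pcong_mult [OF conj [OF poly(1) shift(1) carr(1)]
      pcong_inv [OF conj [OF poly(2) shift(2) carr(2)] S0] poly.inverse [OF S0]]
  have *: "pcong (Suc i) (\<lambda>\<alpha>. Q \<alpha> \<otimes> inv (S \<alpha>))
    (\<lambda>\<alpha>. conjugate G (shift \<beta> Q \<alpha>) k \<otimes> inv (conjugate G (shift \<beta>' S \<alpha>) k'))" .
  have "poly i (\<lambda>\<alpha>. Q \<alpha> \<otimes> inv (S \<alpha>))"
    using poly by (intro poly.mult poly.inverse)
  from poly_pcong [OF this pcong_antimono [OF *]]
  have "poly i (\<lambda>\<alpha>. conjugate G (shift \<beta> Q \<alpha>) k \<otimes> inv (conjugate G (shift \<beta>' S \<alpha>) k'))"
    by simp
  from pcong_trans [OF * pcong_conjugate [OF this carr(3)]] show ?thesis .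
qed

end

section \<open>Ultrafilters in minimal left ideals\<close>

lemma filter_minimal_exists:
  fixes \<A> :: "'c filter set"
  assumes ne: "F \<in> \<A>"
    and chain: "\<And>C. \<lbrakk>C \<noteq> {}; C \<subseteq> \<A>; \<And>x y. \<lbrakk>x \<in> C; y \<in> C\<rbrakk> \<Longrightarrow> x \<le> y \<or> y \<le> x\<rbrakk> \<Longrightarrow> Inf C \<in> \<A>"
  shows "\<exists>M\<in>\<A>. \<forall>X\<in>\<A>. X \<le> M \<longrightarrow> X = M"
proof (rule predicate_Zorn)
  show "partial_order_on \<A> (relation_of (\<lambda>x y. y \<le> x) \<A>)"
    by (rule partial_order_on_relation_ofI) auto
  fix C assume C: "C \<in> Chains (relation_of (\<lambda>x y. y \<le> x) \<A>)"
  show "\<exists>u\<in>\<A>. \<forall>a\<in>C. u \<le> a"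
  proof (cases "C = {}")
    case True
    with ne show ?thesis by auto
  next
    case False
    with C have "Inf C \<in> \<A>"
      by (intro chain) (auto simp: Chains_def relation_of_def)
    then show ?thesis by (auto intro: Inf_lower)
  qed
qed

text \<open>Whatever is eventual for the infimum of a chain is eventual for some member; this
  compactness serves both applications of Zorn's lemma.\<close>

lemma Inf_chain_not_bot:
  fixes C :: "'c filter set"
  assumes "C \<noteq> {}" "\<And>x y. \<lbrakk>x \<in> C; y \<in> C\<rbrakk> \<Longrightarrow> x \<le> y \<or> y \<le> x" "bot \<notin> C"
  shows "Inf C \<noteq> bot"
proof -
  have "eventually (\<lambda>_. False) (Inf C) \<longleftrightarrow> (\<exists>b\<in>C. eventually (\<lambda>_. False) b)"
  proof (rule eventually_Inf_base [OF assms(1)])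
    show "\<exists>x\<in>C. x \<le> inf F G" if "F \<in> C" "G \<in> C" for F G
      using assms(2) [OF that] that by (auto simp: le_inf_iff)
  qed
  with assms(3) show ?thesis by (auto simp: eventually_False)
qed

definition ultra :: "'c filter \<Rightarrow> bool" where
  "ultra p \<longleftrightarrow> p \<noteq> bot \<and> (\<forall>P. eventually P p \<or> eventually (\<lambda>x. \<not> P x) p)"

lemma ultra_not_eventually: "ultra p \<Longrightarrow> \<not> eventually P p \<longleftrightarrow> eventually (\<lambda>x. \<not> P x) p"
  using eventually_conj [of P p "\<lambda>x. \<not> P x"] by (auto simp: ultra_def eventually_False)

lemma ultra_finite_disj:
  assumes "ultra p" "finite K" "eventually (\<lambda>x. \<exists>k\<in>K. P k x) p"
  obtains k where "k \<in> K" "eventually (P k) p"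
proof -
  have False if "\<forall>k\<in>K. \<not> eventually (P k) p"
  proof -
    have "eventually (\<lambda>x. \<forall>k\<in>K. \<not> P k x) p"
      using that assms by (intro eventually_ball_finite) (auto simp: ultra_not_eventually)
    with assms(3) have "eventually (\<lambda>_. False) p"
      by eventually_elim auto
    with assms(1) show False by (simp add: ultra_def eventually_False)
  qed
  then show ?thesis using that by blast
qed

lemma ultra_exists:
  fixes F :: "'c filter"
  assumes "F \<noteq> bot"
  obtains p where "p \<le> F" "ultra p"
proof -
  have "\<exists>M\<in>{q. q \<le> F \<and> q \<noteq> bot}. \<forall>X\<in>{q. q \<le> F \<and> q \<noteq> bot}. X \<le> M \<longrightarrow> X = M"
  proof (rule filter_minimal_exists)
    show "F \<in> {q. q \<le> F \<and> q \<noteq> bot}" using assms by simp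
    fix C :: "'c filter set"
    assume C: "C \<noteq> {}" "C \<subseteq> {q. q \<le> F \<and> q \<noteq> bot}" "\<And>x y. \<lbrakk>x \<in> C; y \<in> C\<rbrakk> \<Longrightarrow> x \<le> y \<or> y \<le> x"
    have "Inf C \<noteq> bot" by (rule Inf_chain_not_bot) (use C in auto)
    moreover have "Inf C \<le> F" using C(1,2) by (auto intro: Inf_lower2)
    ultimately show "Inf C \<in> {q. q \<le> F \<and> q \<noteq> bot}" by simp
  qed
  then obtain M where M: "M \<le> F" "M \<noteq> bot" "\<And>X. \<lbrakk>X \<le> F; X \<noteq> bot; X \<le> M\<rbrakk> \<Longrightarrow> X = M"
    by auto
  have "eventually P M" if "\<not> eventually (\<lambda>x. \<not> P x) M" for P
  proof -
    \<comment> \<open>Restricting \<open>M\<close> to \<open>P\<close> gives a proper filter, which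
      minimality forces to be \<open>M\<close> itself.\<close>
    have "inf M (principal {x. P x}) \<noteq> bot"
      using that by (auto simp: eventually_False [symmetric] eventually_inf_principal)
    with M have "inf M (principal {x. P x}) = M"
      by (meson inf.cobounded1 order_trans)
    moreover have "eventually P (inf M (principal {x. P x}))"
      by (simp add: eventually_inf_principal)
    ultimately show ?thesis by simp
  qed
  with M show ?thesis by (intro that [of M]) (auto simp: ultra_def)
qed

section \<open>Products of filters and minimal left ideals\<close>

context group
begin

definition conv :: "'a filter \<Rightarrow> 'a filter \<Rightarrow> 'a filter" where
  "conv F q = Abs_filter (\<lambda>P. \<forall>\<^sub>F x in F. \<forall>\<^sub>F y in q. P (x \<otimes> y))"

lemma eventually_conv:
  "eventually P (conv F q) \<longleftrightarrow> (\<forall>\<^sub>F x in F. \<forall>\<^sub>F y in q. P (x \<otimes> y))"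
  unfolding conv_def
proof (rule eventually_Abs_filter, unfold_locales)
  show "\<forall>\<^sub>F x in F. \<forall>\<^sub>F y in q. True" by simp
next
  fix P Q assume "\<forall>\<^sub>F x in F. \<forall>\<^sub>F y in q. P (x \<otimes> y)" "\<forall>\<^sub>F x in F. \<forall>\<^sub>F y in q. Q (x \<otimes> y)"
  then show "\<forall>\<^sub>F x in F. \<forall>\<^sub>F y in q. P (x \<otimes> y) \<and> Q (x \<otimes> y)"
    by eventually_elim (rule eventually_conj)
next
  fix P Q assume "\<forall>x. P x \<longrightarrow> Q x" "\<forall>\<^sub>F x in F. \<forall>\<^sub>F y in q. P (x \<otimes> y)"
  from this(2) show "\<forall>\<^sub>F x in F. \<forall>\<^sub>F y in q. Q (x \<otimes> y)"
    by eventually_elim (erule eventually_mono, simp add: \<open>\<forall>x. P x \<longrightarrow> Q x\<close>)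
qed

lemma conv_not_bot: "\<lbrakk>F \<noteq> bot; q \<noteq> bot\<rbrakk> \<Longrightarrow> conv F q \<noteq> bot"
  by (simp add: eventually_False [symmetric] eventually_conv)

lemma ultra_conv:
  assumes "ultra q" "ultra p"
  shows "ultra (conv q p)"
proof -
  have "eventually (\<lambda>x. \<not> P x) (conv q p)" if "\<not> eventually P (conv q p)" for P
    using that by (simp add: eventually_conv ultra_not_eventually [OF assms(1)]
        ultra_not_eventually [OF assms(2)])
  moreover have "conv q p \<noteq> bot"
    using assms by (intro conv_not_bot) (auto simp: ultra_def)
  ultimately show ?thesis by (auto simp: ultra_def)
qed

end

locale idempotent_group_filter = group G for G :: "('a, 'b) monoid_scheme" (structure) +
  fixes \<F> :: "'a filter"
  assumes \<F>_not_bot: "\<F> \<noteq> bot"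
    and \<F>_carrier: "\<forall>\<^sub>F x in \<F>. x \<in> carrier G"
    and \<F>_idem: "eventually P \<F> \<Longrightarrow> \<forall>\<^sub>F x in \<F>. \<forall>\<^sub>F y in \<F>. P (x \<otimes> y)"
begin

definition synd :: "('a \<Rightarrow> bool) \<Rightarrow> bool" where
  "synd B \<longleftrightarrow> (\<forall>V. eventually V \<F> \<longrightarrow>
     (\<exists>K. finite K \<and> (\<forall>k\<in>K. V k) \<and> (\<forall>\<^sub>F x in \<F>. \<exists>k\<in>K. B (k \<otimes> x))))"

text \<open>
  In terms of the compact semigroup of ultrafilters containing \<open>\<F>\<close>, these are the filters of
  closed left ideals; an ultrafilter in a minimal one has the property of
  \<open>minimal_ultrafilter_exists\<close>.
\<close>

definition ideal_filter :: "'a filter \<Rightarrow> bool" where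
  "ideal_filter H \<longleftrightarrow> H \<le> \<F> \<and> H \<noteq> bot \<and> (\<forall>q. q \<le> H \<longrightarrow> ultra q \<longrightarrow> conv \<F> q \<le> H)"

text \<open>This is the left ideal generated by \<open>q\<close>: idempotence of \<open>\<F>\<close>
  splits one generic factor in front of \<open>q\<close> into two.\<close>

lemma ideal_filter_conv:
  assumes "q \<le> \<F>" "q \<noteq> bot" "conv \<F> q \<le> \<F>"
  shows "ideal_filter (conv \<F> q)"
proof -
  have "conv \<F> r \<le> conv \<F> q" if "r \<le> conv \<F> q" for r
  proof (rule filter_leI)
    fix P assume "eventually P (conv \<F> q)"
    then have "\<forall>\<^sub>F x in \<F>. \<forall>\<^sub>F z in q. P (x \<otimes> z)" by (simp add: eventually_conv)
    from \<F>_idem [OF this] \<F>_carrier show "eventually P (conv \<F> r)"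
      unfolding eventually_conv
    proof eventually_elim
      case (elim x)
      from elim(1) \<F>_carrier have "\<forall>\<^sub>F y in \<F>. \<forall>\<^sub>F z in q. P (x \<otimes> (y \<otimes> z))"
      proof eventually_elim
        case (elim y)
        have "\<forall>\<^sub>F z in q. z \<in> carrier G" by (rule filter_leD [OF assms(1) \<F>_carrier])
        with elim(1) show ?case
          by eventually_elim (use elim(2) \<open>x \<in> carrier G\<close> in \<open>simp add: m_assoc\<close>)
      qed
      then have "eventually (\<lambda>w. P (x \<otimes> w)) (conv \<F> q)" by (simp add: eventually_conv)
      then show ?case by (rule filter_leD [OF that])
    qed
  qed
  with assms show ?thesis
    using conv_not_bot [OF \<F>_not_bot assms(2)] by (auto simp: ideal_filter_def)
qed

lemma minimal_ideal_filter_exists: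
  "\<exists>H. ideal_filter H \<and> (\<forall>X. ideal_filter X \<longrightarrow> X \<le> H \<longrightarrow> X = H)"
proof -
  have "\<exists>M\<in>Collect ideal_filter. \<forall>X\<in>Collect ideal_filter. X \<le> M \<longrightarrow> X = M"
  proof (rule filter_minimal_exists)
    have "conv \<F> q \<le> \<F>" if "q \<le> \<F>" for q
    proof (rule filter_leI)
      fix P assume "eventually P \<F>"
      from \<F>_idem [OF this] show "eventually P (conv \<F> q)"
        unfolding eventually_conv by eventually_elim (rule filter_leD [OF that])
    qed
    then show "\<F> \<in> Collect ideal_filter"
      by (simp add: ideal_filter_def \<F>_not_bot)
    fix C assume C: "C \<noteq> {}" "C \<subseteq> Collect ideal_filter" "\<And>x y. \<lbrakk>x \<in> C; y \<in> C\<rbrakk> \<Longrightarrow> x \<le> y \<or> y \<le> x"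
    have "Inf C \<noteq> bot" by (rule Inf_chain_not_bot) (use C in \<open>auto simp: ideal_filter_def\<close>)
    moreover have "Inf C \<le> \<F>"
    proof -
      from C(1) obtain x where "x \<in> C" by blast
      moreover from this C(2) have "x \<le> \<F>" by (auto simp: ideal_filter_def)
      ultimately show ?thesis by (rule Inf_lower2)
    qed
    moreover have "conv \<F> q \<le> Inf C" if "q \<le> Inf C" "ultra q" for q
      using that C(2) by (auto simp: le_Inf_iff ideal_filter_def)
    ultimately show "Inf C \<in> Collect ideal_filter" by (simp add: ideal_filter_def)
  qed
  then show ?thesis by auto
qed

text \<open>If the return set of some \<open>U\<close> were not syndetic, an ultrafilter
  \<open>q\<close> below \<open>\<F>\<close> would avoid its translates by a whole member
  \<open>V\<close> of \<open>\<F>\<close>. Then the complement of \<open>U\<close> is large for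
  \<open>conv \<F> (conv q p)\<close>, which by minimality is the ideal filter above
  \<open>p\<close>.\<close>

lemma minimal_ultrafilter_exists:
  obtains p where "ultra p" "p \<le> \<F>"
    "\<And>U. eventually U p \<Longrightarrow> synd (\<lambda>x. \<forall>\<^sub>F y in p. U (x \<otimes> y))"
proof -
  obtain H where H: "ideal_filter H" and min: "\<And>X. \<lbrakk>ideal_filter X; X \<le> H\<rbrakk> \<Longrightarrow> X = H"
    using minimal_ideal_filter_exists by blast
  have HF: "H \<le> \<F>" and Hconv: "\<And>q. \<lbrakk>q \<le> H; ultra q\<rbrakk> \<Longrightarrow> conv \<F> q \<le> H"
    using H by (auto simp: ideal_filter_def)
  obtain p where p: "p \<le> H" "ultra p"
    using ultra_exists [of H] H by (auto simp: ideal_filter_def)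
  have p_carrier: "\<forall>\<^sub>F y in p. y \<in> carrier G"
    using p(1) HF \<F>_carrier by (meson filter_leD order_trans)
  have "synd (\<lambda>x. \<forall>\<^sub>F y in p. U (x \<otimes> y))" if U: "eventually U p" for U
  proof (rule ccontr)
    let ?B = "\<lambda>x. \<forall>\<^sub>F y in p. U (x \<otimes> y)"
    assume "\<not> synd ?B"
    then obtain V where V: "eventually V \<F>"
      and noK: "\<And>K. \<lbrakk>finite K; \<forall>k\<in>K. V k\<rbrakk> \<Longrightarrow> \<not> (\<forall>\<^sub>F x in \<F>. \<exists>k\<in>K. ?B (k \<otimes> x))"
      unfolding synd_def by blast
    let ?I = "INF k\<in>{k. V k}. principal {x. \<not> ?B (k \<otimes> x)}"
    \<comment> \<open>Finite intersection property: a failure would produce a finite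
      \<open>K\<close> within \<open>V\<close> whose translates cover a member of
      \<open>\<F>\<close>.\<close>
    have "inf \<F> ?I \<noteq> bot"
    proof
      assume "inf \<F> ?I = bot"
      then have "eventually (\<lambda>_. False) (inf \<F> ?I)" by simp
      then obtain P Q where P: "eventually P \<F>" and Q: "eventually Q ?I"
        and PQ: "\<And>x. P x \<Longrightarrow> Q x \<Longrightarrow> False"
        by (auto simp: eventually_inf)
      from Q obtain K where K: "K \<subseteq> {k. V k}" "finite K"
        "eventually Q (INF k\<in>K. principal {x. \<not> ?B (k \<otimes> x)})"
        by (subst (asm) eventually_INF) auto
      then have "\<And>x. \<forall>k\<in>K. \<not> ?B (k \<otimes> x) \<Longrightarrow> Q x"
        by (simp add: INF_principal_finite eventually_principal)
      with PQ have "\<And>x. P x \<Longrightarrow> \<exists>k\<in>K. ?B (k \<otimes> x)" by blast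
      with P have "\<forall>\<^sub>F x in \<F>. \<exists>k\<in>K. ?B (k \<otimes> x)"
        by (rule eventually_mono)
      with noK K show False by blast
    qed
    then obtain q where q: "q \<le> inf \<F> ?I" "ultra q"
      by (rule ultra_exists)
    then have qF: "q \<le> \<F>" by simp
    have qB: "\<forall>\<^sub>F x in q. \<not> ?B (k \<otimes> x)" if "V k" for k
    proof -
      have "?I \<le> principal {x. \<not> ?B (k \<otimes> x)}"
        using that by (intro INF_lower) simp
      with q have "q \<le> principal {x. \<not> ?B (k \<otimes> x)}" by (meson le_infE order_trans)
      then show ?thesis by (simp add: le_principal)
    qed
    let ?r = "conv q p"
    have r: "ultra ?r" by (rule ultra_conv [OF q(2) p(2)])
    have "?r \<le> conv \<F> p"
      by (rule filter_leI) (auto simp: eventually_conv intro: filter_leD [OF qF])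
    with Hconv [OF p] have rH: "?r \<le> H" by simp
    have "ideal_filter (conv \<F> ?r)"
      using Hconv [OF rH r] HF rH r by (intro ideal_filter_conv) (auto simp: ultra_def)
    then have eq: "conv \<F> ?r = H"
      using min Hconv [OF rH r] by blast
    have "eventually (\<lambda>x. \<not> U x) (conv \<F> ?r)"
      unfolding eventually_conv
      using V \<F>_carrier
    proof eventually_elim
      case (elim k)
      have "\<forall>\<^sub>F x in q. x \<in> carrier G" by (rule filter_leD [OF qF \<F>_carrier])
      with qB [OF elim(1)] show ?case
      proof eventually_elim
        case (elim x)
        then have "\<forall>\<^sub>F y in p. \<not> U (k \<otimes> x \<otimes> y)"
          using ultra_not_eventually [OF p(2)] by blast
        with p_carrier show ?case
          by eventually_elim (use elim \<open>k \<in> carrier G\<close> in \<open>simp add: m_assoc\<close>)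
      qed
    qed
    then have "eventually (\<lambda>x. \<not> U x) p"
      unfolding eq by (rule filter_leD [OF p(1)])
    with U p(2) ultra_not_eventually show False by blast
  qed
  moreover have "p \<le> \<F>" using p(1) HF by simp
  ultimately show ?thesis using that p(2) by blast
qed

end

section \<open>Colour focusing\<close>

lemma eventually_ball_finite2:
  assumes "finite A" "finite B" "\<And>x y. \<lbrakk>x \<in> A; y \<in> B\<rbrakk> \<Longrightarrow> eventually (P x y) F"
  shows "\<forall>\<^sub>F z in F. \<forall>x\<in>A. \<forall>y\<in>B. P x y z"
  using assms by (intro eventually_ball_finite ballI) auto

context idempotent_group_filter
begin

text \<open>The usual device for idempotents: unlike \<open>V\<close> itself, this property survives
  right multiplication by a generic element (\<open>star_mult\<close>).\<close>

definition star :: "('a \<Rightarrow> bool) \<Rightarrow> 'a \<Rightarrow> bool" where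
  "star V x \<longleftrightarrow> x \<in> carrier G \<and> V x \<and> (\<forall>\<^sub>F y in \<F>. V (x \<otimes> y))"

lemma starD: "star V x \<Longrightarrow> x \<in> carrier G" "star V x \<Longrightarrow> V x" "star V x \<Longrightarrow> \<forall>\<^sub>F y in \<F>. V (x \<otimes> y)"
  by (simp_all add: star_def)

lemma eventually_star: "eventually V \<F> \<Longrightarrow> eventually (star V) \<F>"
  by (simp add: star_def [abs_def] eventually_conj_iff \<F>_idem \<F>_carrier)

lemma star_mult:
  assumes "star V x"
  shows "\<forall>\<^sub>F y in \<F>. star V (x \<otimes> y)"
  using starD(3) [OF assms] \<F>_idem [OF starD(3) [OF assms]] \<F>_carrier
proof eventually_elim
  case (elim y)
  from elim(2) \<F>_carrier have "\<forall>\<^sub>F z in \<F>. V (x \<otimes> y \<otimes> z)"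
    by eventually_elim (use elim starD(1) [OF assms] in \<open>simp add: m_assoc\<close>)
  with elim starD(1) [OF assms] show ?case by (simp add: star_def)
qed

end

text \<open>
  Conditions (III) and (IV) appear here in the form
  \<open>R\<^sup>c [c, P] = (R P\<^sup>-\<^sup>1)\<^sup>c P\<close> and \<open>R D\<^sub>\<beta> P = R P\<^sup>-\<^sup>1 P(\<cdot> \<union> \<beta>) P(\<beta>)\<^sup>-\<^sup>1\<close>.
\<close>

locale good_system = idempotent_group_filter G \<F>
  for G :: "('a, 'b) monoid_scheme" (structure) and \<F> :: "'a filter" +
  fixes PP :: "(nat set \<Rightarrow> 'a) set"
  assumes PP_closed: "R \<in> PP \<Longrightarrow> R \<alpha> \<in> carrier G"
    and PP_empty: "R \<in> PP \<Longrightarrow> R {} = \<one>"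
    and PP_measurable: "\<lbrakk>R \<in> PP; eventually V \<F>\<rbrakk> \<Longrightarrow> \<forall>\<^sub>F \<alpha> in tails. R \<alpha> = \<one> \<or> V (R \<alpha>)"
    and PP_twist: "\<lbrakk>R \<in> PP; P \<in> PP\<rbrakk> \<Longrightarrow>
      \<forall>\<^sub>F c in \<F>. (\<lambda>\<alpha>. conjugate G (R \<alpha> \<otimes> inv (P \<alpha>)) c \<otimes> P \<alpha>) \<in> PP"
    and PP_derivative: "\<lbrakk>R \<in> PP; P \<in> PP\<rbrakk> \<Longrightarrow> \<exists>C N. eventually C \<F> \<and>
      (\<forall>c \<beta>. C c \<longrightarrow> finite \<beta> \<longrightarrow> \<beta> \<noteq> {} \<longrightarrow> \<beta> \<subseteq> {N..} \<longrightarrow>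
        (\<lambda>\<alpha>. conjugate G (R \<alpha> \<otimes> inv (P \<alpha>) \<otimes> P (\<alpha> \<union> \<beta>) \<otimes> inv (P \<beta>)) c) \<in> PP)"
begin

text \<open>
  The condition on \<open>X\<close> carries no information about \<open>B\<close>; it keeps the elements \<open>R \<alpha> \<otimes> d\<close> generic
  with respect to the filter, which is what makes the statement amenable to induction.
\<close>

definition solvable :: "(nat set \<Rightarrow> 'a) set \<Rightarrow> bool" where
  "solvable S \<longleftrightarrow> (\<forall>B X W N. synd B \<longrightarrow> finite X \<longrightarrow> X \<subseteq> PP \<longrightarrow> eventually W \<F> \<longrightarrow>
     (\<exists>\<alpha> d. finite \<alpha> \<and> \<alpha> \<noteq> {} \<and> \<alpha> \<subseteq> {N..} \<and> d \<in> carrier G \<and>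
       (\<forall>R\<in>X. W (R \<alpha> \<otimes> d)) \<and> (\<forall>R\<in>S. B (R \<alpha> \<otimes> d))))"

lemma solvableD:
  assumes "solvable S" "synd B" "finite X" "X \<subseteq> PP" "eventually W \<F>"
  shows "\<exists>\<alpha> d. finite \<alpha> \<and> \<alpha> \<noteq> {} \<and> \<alpha> \<subseteq> {N..} \<and> d \<in> carrier G \<and>
       (\<forall>R\<in>X. W (R \<alpha> \<otimes> d)) \<and> (\<forall>R\<in>S. B (R \<alpha> \<otimes> d))"
  by (rule assms(1) [unfolded solvable_def, rule_format, OF assms(2-5)])

text \<open>With d = P(\<alpha>)^-1 k P(\<alpha>) z the point P(\<alpha>) d is k P(\<alpha>) z,
  which lies in \<open>B\<close> for a suitable colour k. For R in \<open>X\<close>, R(\<alpha>) d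
  is k times a value of the twisted map times z; measurability makes that value
  \<open>\<one>\<close> or generic, so \<open>W\<close> is met.\<close>

lemma solvable_trivial:
  assumes P: "P \<in> PP" and S: "finite S" "\<And>R. R \<in> S \<Longrightarrow> \<forall>\<^sub>F \<alpha> in tails. R \<alpha> = P \<alpha>"
  shows "solvable S"
  unfolding solvable_def
proof (intro allI impI)
  fix B X W N
  assume B: "synd B" and X: "finite X" "X \<subseteq> PP" and W: "eventually W \<F>"
  let ?tw = "\<lambda>k R \<alpha>. conjugate G (R \<alpha> \<otimes> inv (P \<alpha>)) k \<otimes> P \<alpha>"
  have "\<forall>\<^sub>F c in \<F>. \<forall>R\<in>X. ?tw c R \<in> PP"
    using X PP_twist P by (intro eventually_ball_finite) auto
  with eventually_star [OF W] have "\<forall>\<^sub>F c in \<F>. star W c \<and> (\<forall>R\<in>X. ?tw c R \<in> PP)"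
    by (rule eventually_conj)
  with B obtain K where K: "finite K" "\<And>k. k \<in> K \<Longrightarrow> star W k"
      "\<And>k R. \<lbrakk>k \<in> K; R \<in> X\<rbrakk> \<Longrightarrow> ?tw k R \<in> PP"
    and KB: "\<forall>\<^sub>F x in \<F>. \<exists>k\<in>K. B (k \<otimes> x)"
    unfolding synd_def by (auto 4 4)
  have "\<forall>\<^sub>F \<alpha> in tails. star W (k \<otimes> ?tw k R \<alpha>)" if "k \<in> K" "R \<in> X" for k R
    using PP_measurable [OF K(3) [OF that] star_mult [OF K(2) [OF that(1)]]]
    by eventually_elim (use K(2) [OF that(1)] starD(1) in auto)
  then have "\<forall>\<^sub>F \<alpha> in tails. \<forall>k\<in>K. \<forall>R\<in>X. star W (k \<otimes> ?tw k R \<alpha>)"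
    by (rule eventually_ball_finite2 [OF K(1) X(1)])
  moreover have "\<forall>\<^sub>F \<alpha> in tails. \<forall>\<^sub>F z in \<F>. \<exists>k\<in>K. B (k \<otimes> (P \<alpha> \<otimes> z))"
    using PP_measurable [OF P eventually_star [OF KB]]
  proof eventually_elim
    case (elim \<alpha>)
    then show ?case
    proof
      assume "P \<alpha> = \<one>"
      from KB \<F>_carrier show ?case by eventually_elim (simp add: \<open>P \<alpha> = \<one>\<close>)
    qed (rule starD(3))
  qed
  moreover have "\<forall>\<^sub>F \<alpha> in tails. \<forall>R\<in>S. R \<alpha> = P \<alpha>"
    using S by (intro eventually_ball_finite) auto
  ultimately have "\<forall>\<^sub>F \<alpha> in tails. \<alpha> \<subseteq> {N..} \<and> (\<forall>R\<in>S. R \<alpha> = P \<alpha>) \<and>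
      (\<forall>\<^sub>F z in \<F>. \<exists>k\<in>K. B (k \<otimes> (P \<alpha> \<otimes> z))) \<and> (\<forall>k\<in>K. \<forall>R\<in>X. star W (k \<otimes> ?tw k R \<alpha>))"
    using eventually_tails_ge [of N] by eventually_elim auto
  then obtain \<alpha> where \<alpha>: "finite \<alpha>" "\<alpha> \<noteq> {}" "\<alpha> \<subseteq> {N..}" "\<And>R. R \<in> S \<Longrightarrow> R \<alpha> = P \<alpha>"
    and ev: "\<forall>\<^sub>F z in \<F>. \<exists>k\<in>K. B (k \<otimes> (P \<alpha> \<otimes> z))"
      "\<And>k R. \<lbrakk>k \<in> K; R \<in> X\<rbrakk> \<Longrightarrow> star W (k \<otimes> ?tw k R \<alpha>)"
    by (rule eventually_tails_nonempty) auto
  have "\<forall>\<^sub>F z in \<F>. \<forall>k\<in>K. \<forall>R\<in>X. W (k \<otimes> ?tw k R \<alpha> \<otimes> z)"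
    by (rule eventually_ball_finite2 [OF K(1) X(1) starD(3) [OF ev(2)]])
  with ev(1) \<F>_carrier have "\<forall>\<^sub>F z in \<F>. z \<in> carrier G \<and> (\<exists>k\<in>K. B (k \<otimes> (P \<alpha> \<otimes> z))) \<and>
      (\<forall>k\<in>K. \<forall>R\<in>X. W (k \<otimes> ?tw k R \<alpha> \<otimes> z))"
    by eventually_elim auto
  from eventually_happens' [OF \<F>_not_bot this]
  obtain z k where z: "z \<in> carrier G" and k: "k \<in> K" "B (k \<otimes> (P \<alpha> \<otimes> z))"
    and Wz: "\<And>R. R \<in> X \<Longrightarrow> W (k \<otimes> ?tw k R \<alpha> \<otimes> z)" by blast
  have kc: "k \<in> carrier G" using K(2) [OF k(1)] starD(1) by blast
  define d where "d = inv (P \<alpha>) \<otimes> (k \<otimes> (P \<alpha> \<otimes> z))"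
  have "d \<in> carrier G" using z kc by (simp add: d_def PP_closed P)
  moreover have "W (R \<alpha> \<otimes> d)" if "R \<in> X" for R
  proof -
    have "R \<alpha> \<otimes> d = k \<otimes> ?tw k R \<alpha> \<otimes> z"
      using that X(2) z kc by (simp add: d_def word_simps PP_closed P subset_iff)
    with Wz [OF that] show ?thesis by simp
  qed
  moreover have "B (R \<alpha> \<otimes> d)" if "R \<in> S" for R
    using \<alpha>(4) [OF that] z kc k(2) by (simp add: d_def PP_closed P)
  ultimately show "\<exists>\<alpha> d. finite \<alpha> \<and> \<alpha> \<noteq> {} \<and> \<alpha> \<subseteq> {N..} \<and> d \<in> carrier G \<and>
      (\<forall>R\<in>X. W (R \<alpha> \<otimes> d)) \<and> (\<forall>R\<in>S. B (R \<alpha> \<otimes> d))"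
    using \<alpha> by blast
qed

end

text \<open>
  For \<open>n < m\<close> let \<open>k\<close> be the colour of \<open>f\<^sub>n\<close>, \<open>\<delta> = \<alpha>\<^sub>1 \<union> \<dots> \<union> \<alpha>\<^sub>n\<close>, \<open>\<beta> = \<alpha>\<^sub>n\<^sub>+\<^sub>1 \<union> \<dots> \<union> \<alpha>\<^sub>m\<close>, \<open>\<gamma> = \<delta> \<union> \<beta>\<close>, and write
  \<open>f\<^sub>n = g z\<close>, \<open>f\<^sub>m = h z\<close> with \<open>z\<close> still free. The point \<open>quot P R k \<beta> \<otimes> h \<otimes> z\<close> equals \<open>g e z\<close> with
  \<open>e = position P R k g \<beta> h\<close>. Choosing \<open>\<alpha>\<^sub>m\<^sub>+\<^sub>1 = \<alpha>\<close> and \<open>z = d z'\<close> multiplies \<open>h\<close> by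
  \<open>main_map P \<gamma> h \<alpha> \<otimes> d\<close> and \<open>e\<close> by \<open>new_map P R k \<beta> \<gamma> h \<alpha> \<otimes> d\<close>, so the next step solves the system
  of the \<open>new_map\<close>s. With \<open>T = start_map P R k \<delta> g = ((R P\<^sup>-\<^sup>1)\<^sup>k P \<cdot> D\<^sub>\<delta> P)\<^sup>g\<close> one has
  \<open>new_map P R k \<beta> \<gamma> h = (T \<cdot> D\<^sub>\<beta> T)\<^sup>e\<close>, so conditions (III) and (IV) keep it in the collection as long
  as \<open>k\<close>, \<open>g\<close>, \<open>e\<close> are generic.
\<close>

context group
begin

definition quot :: "(nat set \<Rightarrow> 'a) \<Rightarrow> (nat set \<Rightarrow> 'a) \<Rightarrow> 'a \<Rightarrow> nat set \<Rightarrow> 'a" where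
  "quot P R k = (\<lambda>\<alpha>. conjugate G (R \<alpha> \<otimes> inv (P \<alpha>)) k)"

definition twist :: "(nat set \<Rightarrow> 'a) \<Rightarrow> (nat set \<Rightarrow> 'a) \<Rightarrow> 'a \<Rightarrow> nat set \<Rightarrow> 'a" where
  "twist P R k = (\<lambda>\<alpha>. quot P R k \<alpha> \<otimes> P \<alpha>)"

definition main_map :: "(nat set \<Rightarrow> 'a) \<Rightarrow> nat set \<Rightarrow> 'a \<Rightarrow> nat set \<Rightarrow> 'a" where
  "main_map P \<gamma> h = (\<lambda>\<alpha>. conjugate G (P (\<alpha> \<union> \<gamma>) \<otimes> inv (P \<gamma>)) h)"

definition new_map ::
    "(nat set \<Rightarrow> 'a) \<Rightarrow> (nat set \<Rightarrow> 'a) \<Rightarrow> 'a \<Rightarrow> nat set \<Rightarrow> nat set \<Rightarrow> 'a \<Rightarrow> nat set \<Rightarrow> 'a" where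
  "new_map P R k \<beta> \<gamma> h = (\<lambda>\<alpha>. conjugate G
     (inv (quot P R k \<beta>) \<otimes> quot P R k (\<alpha> \<union> \<beta>) \<otimes> (P (\<alpha> \<union> \<gamma>) \<otimes> inv (P \<gamma>))) h)"

definition start_map ::
    "(nat set \<Rightarrow> 'a) \<Rightarrow> (nat set \<Rightarrow> 'a) \<Rightarrow> 'a \<Rightarrow> nat set \<Rightarrow> 'a \<Rightarrow> nat set \<Rightarrow> 'a" where
  "start_map P R k \<delta> g = (\<lambda>\<alpha>. conjugate G
     (twist P R k \<alpha> \<otimes> inv (P \<alpha>) \<otimes> P (\<alpha> \<union> \<delta>) \<otimes> inv (P \<delta>)) g)"

definition position ::
    "(nat set \<Rightarrow> 'a) \<Rightarrow> (nat set \<Rightarrow> 'a) \<Rightarrow> 'a \<Rightarrow> 'a \<Rightarrow> nat set \<Rightarrow> 'a \<Rightarrow> 'a" where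
  "position P R k g \<beta> h = inv g \<otimes> quot P R k \<beta> \<otimes> h"

end

text \<open>The data of one focusing argument: \<open>K\<close> is the set of colours,
  \<open>p\<close> the minimal ultrafilter, \<open>CC\<close> and \<open>NN\<close> are choice
  functions for \<open>PP_derivative\<close>, \<open>N0\<close> bounds all thresholds known in
  advance, and \<open>IH\<close> solves the systems of new maps.\<close>

locale focusing = good_system G \<F> PP
  for G :: "('a, 'b) monoid_scheme" (structure) and \<F> :: "'a filter" and PP :: "(nat set \<Rightarrow> 'a) set" +
  fixes P :: "nat set \<Rightarrow> 'a" and S X :: "(nat set \<Rightarrow> 'a) set" and W B :: "'a \<Rightarrow> bool"
    and K :: "'a set" and p :: "'a filter"
    and CC :: "(nat set \<Rightarrow> 'a) \<Rightarrow> (nat set \<Rightarrow> 'a) \<Rightarrow> 'a \<Rightarrow> bool"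
    and NN :: "(nat set \<Rightarrow> 'a) \<Rightarrow> (nat set \<Rightarrow> 'a) \<Rightarrow> nat" and N0 :: nat
  assumes P: "P \<in> PP" and X: "finite X" "X \<subseteq> PP" and S: "S \<subseteq> X"
    and p: "ultra p" "p \<le> \<F>"
      "\<And>U. eventually U p \<Longrightarrow> synd (\<lambda>x. \<forall>\<^sub>F y in p. U (x \<otimes> y))"
    and CC: "\<And>R Q. \<lbrakk>R \<in> PP; Q \<in> PP\<rbrakk> \<Longrightarrow> eventually (CC R Q) \<F>"
    and NN: "\<And>R Q c \<beta>. \<lbrakk>R \<in> PP; Q \<in> PP; CC R Q c; finite \<beta>; \<beta> \<noteq> {}; \<beta> \<subseteq> {NN R Q..}\<rbrakk> \<Longrightarrow>
      (\<lambda>\<alpha>. conjugate G (R \<alpha> \<otimes> inv (Q \<alpha>) \<otimes> Q (\<alpha> \<union> \<beta>) \<otimes> inv (Q \<beta>)) c) \<in> PP"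
    and K: "finite K" "\<And>k. k \<in> K \<Longrightarrow> star W k" "\<And>k R. \<lbrakk>k \<in> K; R \<in> X\<rbrakk> \<Longrightarrow> twist P R k \<in> PP"
    and KB: "\<forall>\<^sub>F x in \<F>. \<exists>k\<in>K. B (k \<otimes> x)"
    and N0: "NN P P \<le> N0" "\<And>k R. \<lbrakk>k \<in> K; R \<in> X\<rbrakk> \<Longrightarrow> NN (twist P R k) P \<le> N0"
    and IH: "\<And>L \<beta> \<gamma> h. \<lbrakk>L \<subseteq> K; L \<noteq> {}; h \<in> carrier G; \<And>k. k \<in> L \<Longrightarrow> finite (\<beta> k) \<and> \<beta> k \<subseteq> {N0..};
        \<And>k R. \<lbrakk>k \<in> L; R \<in> S\<rbrakk> \<Longrightarrow> new_map P R k (\<beta> k) \<gamma> h \<in> PP\<rbrakk> \<Longrightarrow>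
      solvable {new_map P R k (\<beta> k) \<gamma> h | R k. k \<in> L \<and> R \<in> S}"
begin

section \<open>Genericity conditions carried through the construction\<close>

lemma P_closed [simp]: "P \<alpha> \<in> carrier G"
  by (rule PP_closed [OF P])

lemma X_closed: "R \<in> X \<Longrightarrow> R \<alpha> \<in> carrier G"
  using X PP_closed by blast

lemma K_carrier: "k \<in> K \<Longrightarrow> k \<in> carrier G"
  using K(2) starD(1) by blast

lemma quot_closed [simp]: "\<lbrakk>R \<in> X; k \<in> K\<rbrakk> \<Longrightarrow> quot P R k \<alpha> \<in> carrier G"
  by (simp add: quot_def X_closed K_carrier)

lemma quot_empty [simp]: "\<lbrakk>R \<in> X; k \<in> K\<rbrakk> \<Longrightarrow> quot P R k {} = \<one>"
  using X(2) by (simp add: quot_def conjugate_def PP_empty P K_carrier subset_iff)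

text \<open>Demands on a chosen point: it has a colour, its translates by colours stay generic for
  \<open>W\<close>, and conjugation by it keeps main maps and start maps in
  \<open>PP\<close>.\<close>

definition Vmain :: "'a \<Rightarrow> bool" where
  "Vmain h \<longleftrightarrow> CC P P h \<and> (\<exists>k\<in>K. B (k \<otimes> h)) \<and> (\<forall>k\<in>K. star W (k \<otimes> h)) \<and>
     (\<forall>k\<in>K. \<forall>R\<in>X. CC (twist P R k) P h)"

lemma eventually_Vmain: "eventually Vmain \<F>"
proof -
  have "\<forall>\<^sub>F h in \<F>. \<forall>k\<in>K. star W (k \<otimes> h)"
    using K(1) star_mult [OF K(2)] by (intro eventually_ball_finite) auto
  moreover have "\<forall>\<^sub>F h in \<F>. \<forall>k\<in>K. \<forall>R\<in>X. CC (twist P R k) P h"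
    by (rule eventually_ball_finite2 [OF K(1) X(1) CC [OF K(3) P]])
  ultimately show ?thesis
    using CC [OF P P] KB unfolding Vmain_def by eventually_elim blast
qed

definition Ventry :: "(nat set \<Rightarrow> 'a) \<Rightarrow> 'a \<Rightarrow> nat set \<Rightarrow> 'a \<Rightarrow> 'a \<Rightarrow> bool" where
  "Ventry R k \<delta> g y \<longleftrightarrow> star W (k \<otimes> (g \<otimes> y)) \<and> CC (start_map P R k \<delta> g) (start_map P R k \<delta> g) y"

text \<open>The record for one colour: \<open>\<delta>\<close> and \<open>g\<close> are frozen when
  the colour first occurs, \<open>\<beta>\<close> is the block gathered since. Genericity is asked
  after a further factor \<open>y\<close> because a fresh entry has position
  \<open>\<one>\<close>.\<close>

definition entry :: "'a \<Rightarrow> nat set \<Rightarrow> 'a \<Rightarrow> nat set \<Rightarrow> nat set \<Rightarrow> 'a \<Rightarrow> bool" where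
  "entry k \<delta> g \<beta> \<gamma> h \<longleftrightarrow> finite \<beta> \<and> \<delta> \<union> \<beta> = \<gamma> \<and> g \<in> carrier G \<and>
     (\<forall>R\<in>X. start_map P R k \<delta> g \<in> PP \<and> new_map P R k \<beta> \<gamma> h \<in> PP \<and>
       \<beta> \<subseteq> {NN (start_map P R k \<delta> g) (start_map P R k \<delta> g)..} \<and>
       (\<forall>\<^sub>F y in \<F>. star (Ventry R k \<delta> g) (position P R k g \<beta> h \<otimes> y)))"

lemma main_map_in_PP:
  assumes "star Vmain h" "finite \<gamma>" "\<gamma> \<noteq> {}" "\<gamma> \<subseteq> {N0..}"
  shows "main_map P \<gamma> h \<in> PP"
proof -
  have "\<gamma> \<subseteq> {NN P P..}" using N0(1) assms(4) by auto
  from NN [OF P P _ assms(2,3) this, of h] show ?thesis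
    using starD [OF assms(1)] by (simp add: main_map_def Vmain_def)
qed

lemma entry_new:
  assumes h: "star Vmain h" and \<gamma>: "finite \<gamma>" "\<gamma> \<noteq> {}" "\<gamma> \<subseteq> {N0..}" and k: "k \<in> K"
  shows "entry k \<gamma> h {} \<gamma> h"
proof -
  have hc [simp]: "h \<in> carrier G" by (rule starD(1) [OF h])
  have Vh: "Vmain h" by (rule starD(2) [OF h])
  have "start_map P R k \<gamma> h \<in> PP \<and> new_map P R k {} \<gamma> h \<in> PP \<and>
      (\<forall>\<^sub>F y in \<F>. star (Ventry R k \<gamma> h) (position P R k h {} h \<otimes> y))" if R: "R \<in> X" for R
  proof -
    have "\<gamma> \<subseteq> {NN (twist P R k) P..}" using N0(2) [OF k R] \<gamma>(3) by auto
    from NN [OF K(3) [OF k R] P _ \<gamma>(1,2) this, of h]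
    have s: "start_map P R k \<gamma> h \<in> PP"
      using Vh k R by (simp add: start_map_def Vmain_def)
    have eq: "new_map P R k {} \<gamma> h = start_map P R k \<gamma> h"
      using R k by (simp add: new_map_def start_map_def twist_def m_assoc fun_eq_iff)
    have "star W (k \<otimes> h)" using Vh k by (simp add: Vmain_def)
    from star_mult [OF this] \<F>_carrier have "\<forall>\<^sub>F y in \<F>. star W (k \<otimes> (h \<otimes> y))"
      by eventually_elim (simp add: m_assoc K_carrier k)
    with CC [OF s s] have "eventually (Ventry R k \<gamma> h) \<F>"
      unfolding Ventry_def by eventually_elim simp
    from eventually_star [OF this] \<F>_carrier
    have "\<forall>\<^sub>F y in \<F>. star (Ventry R k \<gamma> h) (position P R k h {} h \<otimes> y)"
      by eventually_elim (simp add: position_def R k)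
    with s eq show ?thesis by simp
  qed
  then show ?thesis by (simp add: entry_def)
qed

lemma position_new_map:
  assumes "R \<in> X" "k \<in> K" "g \<in> carrier G" "h \<in> carrier G" "d \<in> carrier G"
  shows "position P R k g \<beta> h \<otimes> (new_map P R k \<beta> \<gamma> h \<alpha> \<otimes> d) =
    position P R k g (\<beta> \<union> \<alpha>) (h \<otimes> (main_map P \<gamma> h \<alpha> \<otimes> d))"
  using assms by (simp add: position_def new_map_def main_map_def word_simps Un_commute)

lemma quot_new_map:
  assumes "R \<in> X" "k \<in> K" "h \<in> carrier G" "d \<in> carrier G" "z \<in> carrier G"
  shows "quot P R k \<beta> \<otimes> h \<otimes> (new_map P R k \<beta> \<gamma> h \<alpha> \<otimes> d \<otimes> z) =
    quot P R k (\<beta> \<union> \<alpha>) \<otimes> (h \<otimes> (main_map P \<gamma> h \<alpha> \<otimes> d)) \<otimes> z"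
  using assms by (simp add: new_map_def main_map_def word_simps Un_commute)

text \<open>In T(\<alpha> \<union> \<beta>) T(\<beta>)^-1 the values of \<open>P\<close> at
  \<open>\<delta>\<close> cancel, and the position turns conjugation by \<open>g\<close> into
  conjugation by \<open>quot P R k \<beta>\<close> and \<open>h\<close>.\<close>

lemma new_map_eq_derivative:
  assumes "R \<in> X" "k \<in> K" "g \<in> carrier G" "h \<in> carrier G" "\<delta> \<union> \<beta> = \<gamma>"
  defines "T \<equiv> start_map P R k \<delta> g"
  shows "new_map P R k \<beta> \<gamma> h =
    (\<lambda>\<alpha>. conjugate G (T \<alpha> \<otimes> inv (T \<alpha>) \<otimes> T (\<alpha> \<union> \<beta>) \<otimes> inv (T \<beta>)) (position P R k g \<beta> h))"
proof
  fix \<alpha>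
  have 1: "P (\<alpha> \<union> \<beta> \<union> \<delta>) = P (\<alpha> \<union> \<gamma>)" "P (\<beta> \<union> \<delta>) = P \<gamma>"
    using assms(5) by (auto simp: ac_simps)
  have T: "T \<alpha>' \<in> carrier G" for \<alpha>'
    using assms(1-4) by (simp add: T_def start_map_def twist_def)
  have T1: "T (\<alpha> \<union> \<beta>) = conjugate G (quot P R k (\<alpha> \<union> \<beta>) \<otimes> P (\<alpha> \<union> \<gamma>) \<otimes> inv (P \<delta>)) g"
    and T2: "T \<beta> = conjugate G (quot P R k \<beta> \<otimes> P \<gamma> \<otimes> inv (P \<delta>)) g"
    using assms(1-4) by (simp_all add: T_def start_map_def twist_def 1 m_assoc)
  show "new_map P R k \<beta> \<gamma> h \<alpha> =
      conjugate G (T \<alpha> \<otimes> inv (T \<alpha>) \<otimes> T (\<alpha> \<union> \<beta>) \<otimes> inv (T \<beta>)) (position P R k g \<beta> h)"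
    unfolding r_inv [OF T] T1 T2
    using assms(1-4) by (simp add: new_map_def position_def word_simps)
qed

text \<open>Condition (IV) is applied to the start map with itself and the block
  \<open>\<beta> \<union> \<alpha>\<close>, which is nonempty even for a fresh entry because
  \<open>\<alpha>\<close> is.\<close>

lemma entry_step:
  assumes e: "entry k \<delta> g \<beta> \<gamma> h" and k: "k \<in> K" and h: "h \<in> carrier G" and d: "d \<in> carrier G"
    and \<alpha>: "finite \<alpha>" "\<alpha> \<noteq> {}"
      "\<And>R. R \<in> X \<Longrightarrow> \<alpha> \<subseteq> {NN (start_map P R k \<delta> g) (start_map P R k \<delta> g)..}"
    and V: "\<And>R. R \<in> X \<Longrightarrow>
      star (Ventry R k \<delta> g) (position P R k g \<beta> h \<otimes> (new_map P R k \<beta> \<gamma> h \<alpha> \<otimes> d))"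
  defines "h' \<equiv> h \<otimes> (main_map P \<gamma> h \<alpha> \<otimes> d)"
  shows "entry k \<delta> g (\<beta> \<union> \<alpha>) (\<gamma> \<union> \<alpha>) h'"
    and "\<And>R. R \<in> X \<Longrightarrow> star (Ventry R k \<delta> g) (position P R k g (\<beta> \<union> \<alpha>) h')"
proof -
  have g: "g \<in> carrier G" and \<beta>: "finite \<beta>" and \<gamma>: "\<delta> \<union> \<beta> = \<gamma>"
    using e by (auto simp: entry_def)
  have h': "h' \<in> carrier G" using h d by (simp add: h'_def main_map_def)
  show V': "star (Ventry R k \<delta> g) (position P R k g (\<beta> \<union> \<alpha>) h')" if "R \<in> X" for R
    using V [OF that] position_new_map [OF that k g h d] by (simp add: h'_def)
  have "new_map P R k (\<beta> \<union> \<alpha>) (\<gamma> \<union> \<alpha>) h' \<in> PP" if R: "R \<in> X" for R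
  proof -
    let ?T = "start_map P R k \<delta> g"
    have T: "?T \<in> PP" "\<beta> \<subseteq> {NN ?T ?T..}"
      using e R by (auto simp: entry_def)
    have "\<delta> \<union> (\<beta> \<union> \<alpha>) = \<gamma> \<union> \<alpha>" using \<gamma> by auto
    from new_map_eq_derivative [OF R k g h' this] show ?thesis
      using NN [OF T(1) T(1), of "position P R k g (\<beta> \<union> \<alpha>) h'" "\<beta> \<union> \<alpha>"]
        starD(2) [OF V' [OF R]] \<beta> \<alpha>(1,2) \<alpha>(3) [OF R] T(2) by (simp add: Ventry_def)
  qed
  with e \<alpha> star_mult [OF V'] show "entry k \<delta> g (\<beta> \<union> \<alpha>) (\<gamma> \<union> \<alpha>) h'"
    unfolding entry_def by auto
qed

text \<open>
  \<open>L\<close> is the set of colours already used, one entry for each; \<open>U\<close> is the set of \<open>z\<close> for which all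
  points constructed so far, continued by \<open>z\<close>, have the prescribed colours.
\<close>

definition state ::
  "'a set \<Rightarrow> ('a \<Rightarrow> nat set) \<Rightarrow> ('a \<Rightarrow> 'a) \<Rightarrow> ('a \<Rightarrow> nat set) \<Rightarrow> nat set \<Rightarrow> 'a \<Rightarrow> ('a \<Rightarrow> bool) \<Rightarrow> bool"
  where
  "state L \<delta> g \<beta> \<gamma> h U \<longleftrightarrow> L \<subseteq> K \<and> L \<noteq> {} \<and> finite \<gamma> \<and> \<gamma> \<noteq> {} \<and> \<gamma> \<subseteq> {N0..} \<and>
     star Vmain h \<and> eventually U p \<and>
     (\<forall>k\<in>L. entry k (\<delta> k) (g k) (\<beta> k) \<gamma> h \<and>
       (\<forall>z\<in>carrier G. U z \<longrightarrow> (\<forall>R\<in>S. B (k \<otimes> (quot P R k (\<beta> k) \<otimes> h \<otimes> z)))))"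

text \<open>With d = P(\<beta>)^-1 k x, the points displayed are R(\<beta>) d, and P(\<beta>) d = k
  x; so this solves the system \<open>S\<close> together with \<open>P\<close>.\<close>

definition goal :: bool where
  "goal \<longleftrightarrow> (\<exists>\<beta> k x. finite \<beta> \<and> \<beta> \<noteq> {} \<and> \<beta> \<subseteq> {N0..} \<and> k \<in> K \<and> x \<in> carrier G \<and>
     (\<forall>R\<in>X. W (k \<otimes> (quot P R k \<beta> \<otimes> x))) \<and> (\<forall>R\<in>S. B (k \<otimes> (quot P R k \<beta> \<otimes> x))) \<and> B (k \<otimes> x))"

lemma p_carrier: "\<forall>\<^sub>F z in p. z \<in> carrier G"
  by (rule filter_leD [OF p(2) \<F>_carrier])

lemma colour_exists:
  assumes "star Vmain h"
  obtains k where "k \<in> K" "\<forall>\<^sub>F z in p. B (k \<otimes> (h \<otimes> z))"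
proof -
  have "\<forall>\<^sub>F z in \<F>. \<exists>k\<in>K. B (k \<otimes> (h \<otimes> z))"
    using starD(3) [OF assms] by eventually_elim (simp add: Vmain_def)
  then have "\<forall>\<^sub>F z in p. \<exists>k\<in>K. B (k \<otimes> (h \<otimes> z))" by (rule filter_leD [OF p(2)])
  from ultra_finite_disj [OF p(1) K(1) this] that show ?thesis by blast
qed

lemma state_init: "\<exists>L \<delta> g \<beta> \<gamma> h U. state L \<delta> g \<beta> \<gamma> h U"
proof -
  from eventually_happens' [OF \<F>_not_bot eventually_star [OF eventually_Vmain]]
  obtain h where h: "star Vmain h" by blast
  obtain k where k: "k \<in> K" "\<forall>\<^sub>F z in p. B (k \<otimes> (h \<otimes> z))"
    using colour_exists [OF h] .
  have "state {k} (\<lambda>_. {N0}) (\<lambda>_. h) (\<lambda>_. {}) {N0} h (\<lambda>z. B (k \<otimes> (h \<otimes> z)))"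
    using h k entry_new [OF h _ _ _ k(1), of "{N0}"] starD(1) [OF h] S
    by (auto simp: state_def subset_iff)
  then show ?thesis by blast
qed

text \<open>The next point either repeats a recorded colour, which gives the goal, or contributes a
  new colour.\<close>

lemma state_step:
  assumes st: "state L \<delta> g \<beta> \<gamma> h U"
  shows "goal \<or> (\<exists>k\<in>K - L. \<exists>\<delta> g \<beta> \<gamma> h U. state (insert k L) \<delta> g \<beta> \<gamma> h U)"
proof -
  have L: "L \<subseteq> K" "L \<noteq> {}" and \<gamma>: "finite \<gamma>" "\<gamma> \<noteq> {}" "\<gamma> \<subseteq> {N0..}" and h: "star Vmain h"
    and U: "eventually U p" and ent: "\<And>k. k \<in> L \<Longrightarrow> entry k (\<delta> k) (g k) (\<beta> k) \<gamma> h"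
    and UB: "\<And>k z R. \<lbrakk>k \<in> L; z \<in> carrier G; U z; R \<in> S\<rbrakk> \<Longrightarrow> B (k \<otimes> (quot P R k (\<beta> k) \<otimes> h \<otimes> z))"
    using st by (auto simp: state_def)
  have finL: "finite L" using L(1) K(1) finite_subset by blast
  have LK: "k \<in> K" if "k \<in> L" for k using L(1) that by blast
  have SX: "R \<in> X" if "R \<in> S" for R using S that by blast
  have hc: "h \<in> carrier G" by (rule starD(1) [OF h])
  let ?S' = "{new_map P R k (\<beta> k) \<gamma> h | R k. k \<in> L \<and> R \<in> S}"
  \<comment> \<open>Only the new maps from \<open>S\<close> have to hit the target set; the main map
    and the new maps from all of \<open>X\<close> need only keep the next point and positions
    generic.\<close>
  let ?X' = "insert (main_map P \<gamma> h) ((\<lambda>(k, R). new_map P R k (\<beta> k) \<gamma> h) ` (L \<times> X))"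
  let ?W' = "\<lambda>y. star Vmain (h \<otimes> y) \<and> (\<forall>k\<in>L. \<forall>R\<in>X.
    star (Ventry R k (\<delta> k) (g k)) (position P R k (g k) (\<beta> k) h \<otimes> y))"
  have new_PP: "new_map P R k (\<beta> k) \<gamma> h \<in> PP" if "k \<in> L" "R \<in> X" for k R
    using ent [OF that(1)] that(2) by (simp add: entry_def)
  have \<beta>N0: "finite (\<beta> k) \<and> \<beta> k \<subseteq> {N0..}" if "k \<in> L" for k
    using ent [OF that] \<gamma>(3) by (auto simp: entry_def)
  have sol: "solvable ?S'"
    by (rule IH) (use L hc \<beta>N0 new_PP SX in auto)
  have X'fin: "finite ?X'" using finL X(1) by simp
  have X'PP: "?X' \<subseteq> PP" using main_map_in_PP [OF h \<gamma>] new_PP by auto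
  have "\<forall>\<^sub>F y in \<F>. \<forall>k\<in>L. \<forall>R\<in>X.
      star (Ventry R k (\<delta> k) (g k)) (position P R k (g k) (\<beta> k) h \<otimes> y)"
    by (rule eventually_ball_finite2 [OF finL X(1)]) (use ent in \<open>simp add: entry_def\<close>)
  with star_mult [OF h] have W': "eventually ?W' \<F>" by (rule eventually_conj)
  define T where "T = (\<lambda>k R. start_map P R k (\<delta> k) (g k))"
  \<comment> \<open>The start maps depend on the run so far, so their thresholds are not covered by
    \<open>N0\<close>.\<close>
  define N where "N = Max (insert N0 ((\<lambda>(k, R). NN (T k R) (T k R)) ` (L \<times> X)))"
  have fin: "finite (insert N0 ((\<lambda>(k, R). NN (T k R) (T k R)) ` (L \<times> X)))"
    using finL X(1) by simp
  have N0N: "N0 \<le> N"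
    unfolding N_def by (rule Max_ge [OF fin]) simp
  have NNN: "NN (T k R) (T k R) \<le> N" if "k \<in> L" "R \<in> X" for k R
    unfolding N_def
  proof (rule Max_ge [OF fin], rule insertI2)
    show "NN (T k R) (T k R) \<in> (\<lambda>(k, R). NN (T k R) (T k R)) ` (L \<times> X)"
      by (rule image_eqI [of _ _ "(k, R)"]) (use that in auto)
  qed
  \<comment> \<open>The induction hypothesis needs a syndetic target: \<open>U\<close> is replaced
    by the set of x with U(x y) for \<open>p\<close>-almost all y.\<close>
  obtain \<alpha> d where \<alpha>: "finite \<alpha>" "\<alpha> \<noteq> {}" "\<alpha> \<subseteq> {N..}" and d: "d \<in> carrier G"
    and "\<forall>R\<in>?X'. ?W' (R \<alpha> \<otimes> d)" and "\<forall>R\<in>?S'. \<forall>\<^sub>F y in p. U (R \<alpha> \<otimes> d \<otimes> y)"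
    using solvableD [OF sol p(3) [OF U] X'fin X'PP W', of N] by (elim exE conjE)
  note W\<alpha> = bspec [OF this(5)] and U\<alpha> = bspec [OF this(6)]
  define h' where "h' = h \<otimes> (main_map P \<gamma> h \<alpha> \<otimes> d)"
  have h': "star Vmain h'" using W\<alpha> [of "main_map P \<gamma> h"] by (simp add: h'_def)
  have h'c: "h' \<in> carrier G" by (rule starD(1) [OF h'])
  have \<alpha>T: "\<alpha> \<subseteq> {NN (start_map P R k (\<delta> k) (g k)) (start_map P R k (\<delta> k) (g k))..}"
    if "k \<in> L" "R \<in> X" for k R
    using \<alpha>(3) NNN [OF that] by (auto simp: T_def)
  have V\<alpha>: "star (Ventry R k (\<delta> k) (g k))
      (position P R k (g k) (\<beta> k) h \<otimes> (new_map P R k (\<beta> k) \<gamma> h \<alpha> \<otimes> d))" if "k \<in> L" "R \<in> X" for k R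
  proof -
    have "new_map P R k (\<beta> k) \<gamma> h \<in> ?X'"
      by (rule insertI2, rule image_eqI [of _ _ "(k, R)"]) (use that in auto)
    from W\<alpha> [OF this] that show ?thesis by simp
  qed
  have ent': "entry k (\<delta> k) (g k) (\<beta> k \<union> \<alpha>) (\<gamma> \<union> \<alpha>) h'" if "k \<in> L" for k
    unfolding h'_def
    by (rule entry_step(1) [OF ent [OF that] LK [OF that] hc d \<alpha>(1,2) \<alpha>T [OF that] V\<alpha> [OF that]])
  have pos': "star (Ventry R k (\<delta> k) (g k)) (position P R k (g k) (\<beta> k \<union> \<alpha>) h')"
    if "k \<in> L" "R \<in> X" for k R
    unfolding h'_def
    by (rule entry_step(2) [OF ent [OF that(1)] LK [OF that(1)] hc d \<alpha>(1,2) \<alpha>T [OF that(1)]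
          V\<alpha> [OF that(1)] that(2)])
  obtain k' where k': "k' \<in> K" "\<forall>\<^sub>F z in p. B (k' \<otimes> (h' \<otimes> z))"
    using colour_exists [OF h'] .
  define U' where "U' = (\<lambda>z. B (k' \<otimes> (h' \<otimes> z)) \<and>
    (\<forall>k\<in>L. \<forall>R\<in>S. U (new_map P R k (\<beta> k) \<gamma> h \<alpha> \<otimes> d \<otimes> z)))"
  have "\<forall>\<^sub>F z in p. U (new_map P R k (\<beta> k) \<gamma> h \<alpha> \<otimes> d \<otimes> z)" if "k \<in> L" "R \<in> S" for k R
    by (rule U\<alpha>) (use that in blast)
  then have "\<forall>\<^sub>F z in p. \<forall>k\<in>L. \<forall>R\<in>S. U (new_map P R k (\<beta> k) \<gamma> h \<alpha> \<otimes> d \<otimes> z)"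
    by (rule eventually_ball_finite2 [OF finL finite_subset [OF S X(1)]])
  with k'(2) have U': "eventually U' p"
    unfolding U'_def by (rule eventually_conj)
  have UB': "B (k \<otimes> (quot P R k (\<beta> k \<union> \<alpha>) \<otimes> h' \<otimes> z))"
    if "k \<in> L" "z \<in> carrier G" "U' z" "R \<in> S" for k z R
  proof -
    have "new_map P R k (\<beta> k) \<gamma> h \<alpha> \<otimes> d \<otimes> z \<in> carrier G"
      using PP_closed [OF new_PP [OF that(1) SX [OF that(4)]]] d that(2) by simp
    from UB [OF that(1) this _ that(4)] that(3)
    have "B (k \<otimes> (quot P R k (\<beta> k) \<otimes> h \<otimes> (new_map P R k (\<beta> k) \<gamma> h \<alpha> \<otimes> d \<otimes> z)))"
      using that by (simp add: U'_def)
    then show ?thesis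
      using quot_new_map [OF SX [OF that(4)] LK [OF that(1)] hc d that(2)] by (simp add: h'_def)
  qed
  show ?thesis
  proof (cases "k' \<in> L")
    \<comment> \<open>The colour has occurred before; the block
      \<open>\<beta> k' \<union> \<alpha>\<close> between the two occurrences is the required
      set.\<close>
    case True
    have gk: "g k' \<in> carrier G" using ent [OF True] by (simp add: entry_def)
    have "\<forall>\<^sub>F z in \<F>. W (k' \<otimes> (quot P R k' (\<beta> k' \<union> \<alpha>) \<otimes> (h' \<otimes> z)))" if "R \<in> X" for R
    proof -
      have "star W (k' \<otimes> (g k' \<otimes> position P R k' (g k') (\<beta> k' \<union> \<alpha>) h'))"
        using starD(2) [OF pos' [OF True that]] by (simp add: Ventry_def)
      from starD(3) [OF this] \<F>_carrier show ?thesis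
        by eventually_elim (use that k'(1) gk h'c in \<open>simp add: position_def m_assoc K_carrier\<close>)
    qed
    then have "\<forall>\<^sub>F z in \<F>. \<forall>R\<in>X. W (k' \<otimes> (quot P R k' (\<beta> k' \<union> \<alpha>) \<otimes> (h' \<otimes> z)))"
      using X(1) by (intro eventually_ball_finite) auto
    then have "\<forall>\<^sub>F z in p. \<forall>R\<in>X. W (k' \<otimes> (quot P R k' (\<beta> k' \<union> \<alpha>) \<otimes> (h' \<otimes> z)))"
      by (rule filter_leD [OF p(2)])
    with U' p_carrier have "\<forall>\<^sub>F z in p. z \<in> carrier G \<and> U' z \<and>
        (\<forall>R\<in>X. W (k' \<otimes> (quot P R k' (\<beta> k' \<union> \<alpha>) \<otimes> (h' \<otimes> z))))"
      by eventually_elim auto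
    moreover have "p \<noteq> bot" using p(1) by (simp add: ultra_def)
    ultimately obtain z where z: "z \<in> carrier G" "U' z"
      "\<And>R. R \<in> X \<Longrightarrow> W (k' \<otimes> (quot P R k' (\<beta> k' \<union> \<alpha>) \<otimes> (h' \<otimes> z)))"
      using eventually_happens' [of p "\<lambda>z. z \<in> carrier G \<and> U' z \<and>
        (\<forall>R\<in>X. W (k' \<otimes> (quot P R k' (\<beta> k' \<union> \<alpha>) \<otimes> (h' \<otimes> z))))"] by auto
    have "B (k' \<otimes> (quot P R k' (\<beta> k' \<union> \<alpha>) \<otimes> (h' \<otimes> z)))" if "R \<in> S" for R
      using UB' [OF True z(1,2) that] z(1) h'c k'(1) SX [OF that] by (simp add: m_assoc)
    moreover have "B (k' \<otimes> (h' \<otimes> z))" using z(2) by (simp add: U'_def)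
    moreover have "finite (\<beta> k' \<union> \<alpha>)" "\<beta> k' \<union> \<alpha> \<noteq> {}" "\<beta> k' \<union> \<alpha> \<subseteq> {N0..}"
      using \<beta>N0 [OF True] \<alpha> N0N by auto
    ultimately have goal
      unfolding goal_def
      by (intro exI [of _ "\<beta> k' \<union> \<alpha>"] exI [of _ k'] exI [of _ "h' \<otimes> z"] conjI ballI)
        (simp_all add: z k'(1) h'c)
    then show ?thesis ..
  next
    case False
    \<comment> \<open>The fresh colour starts with an empty block, and the older blocks absorb
      \<open>\<alpha>\<close>.\<close>
    let ?\<delta> = "\<delta>(k' := \<gamma> \<union> \<alpha>)" and ?g = "g(k' := h')" and ?\<beta> = "\<lambda>k. if k = k' then {} else \<beta> k \<union> \<alpha>"
    have \<gamma>': "finite (\<gamma> \<union> \<alpha>)" "\<gamma> \<union> \<alpha> \<noteq> {}" "\<gamma> \<union> \<alpha> \<subseteq> {N0..}"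
      using \<gamma> \<alpha> N0N by auto
    have "entry k (?\<delta> k) (?g k) (?\<beta> k) (\<gamma> \<union> \<alpha>) h' \<and>
        (\<forall>z\<in>carrier G. U' z \<longrightarrow> (\<forall>R\<in>S. B (k \<otimes> (quot P R k (?\<beta> k) \<otimes> h' \<otimes> z))))"
      if "k \<in> insert k' L" for k
    proof (cases "k = k'")
      case True
      have "B (k' \<otimes> (quot P R k' {} \<otimes> h' \<otimes> z))" if "U' z" "R \<in> S" for R z
        using that k'(1) h'c SX by (simp add: U'_def)
      with True entry_new [OF h' \<gamma>' k'(1)] show ?thesis by simp
    next
      case neq: False
      with that have "k \<in> L" by simp
      with neq ent' UB' show ?thesis by simp
    qed
    then have "state (insert k' L) ?\<delta> ?g ?\<beta> (\<gamma> \<union> \<alpha>) h' U'"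
      unfolding state_def using L(1) k'(1) \<gamma>' h' U' by simp
    with False k'(1) show ?thesis by blast
  qed
qed

text \<open>Pigeonhole: every step that misses the goal uses up a colour of the finite set
  \<open>K\<close>.\<close>

lemma goal_holds: goal
proof (rule ccontr)
  assume no: "\<not> goal"
  have "\<exists>L \<delta> g \<beta> \<gamma> h U. state L \<delta> g \<beta> \<gamma> h U \<and> n < card L" for n
  proof (induction n)
    case 0
    from state_init obtain L \<delta> g \<beta> \<gamma> h U where st: "state L \<delta> g \<beta> \<gamma> h U" by blast
    then have "L \<subseteq> K" "L \<noteq> {}" by (auto simp: state_def)
    then have "0 < card L" using K(1) finite_subset by (auto simp: card_gt_0_iff)
    with st show ?case by blast
  next
    case (Suc n)
    then obtain L \<delta> g \<beta> \<gamma> h U where st: "state L \<delta> g \<beta> \<gamma> h U" "n < card L" by blast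
    then have "finite L" using K(1) finite_subset by (auto simp: state_def)
    from state_step [OF st(1)] no obtain k \<delta> g \<beta> \<gamma> h U
      where "k \<in> K - L" "state (insert k L) \<delta> g \<beta> \<gamma> h U" by blast
    moreover from this(1) \<open>finite L\<close> st(2) have "Suc n < card (insert k L)" by simp
    ultimately show ?case by blast
  qed
  from this [of "card K"] obtain L where L: "L \<subseteq> K" "card K < card L"
    unfolding state_def by blast
  from card_mono [OF K(1) L(1)] L(2) show False by simp
qed

end

section \<open>From focusing to solvability\<close>

context good_system
begin

text \<open>Focusing runs over \<open>S0\<close> only; the maps outside it agree with
  \<open>P\<close> on late sets and are served by the point P(\<beta>) d = k x.\<close>

lemma solvable_step:
  assumes P: "P \<in> PP" and S: "finite S" "S \<subseteq> PP" "S0 \<subseteq> S"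
    and triv: "\<And>R. R \<in> S - S0 \<Longrightarrow> \<forall>\<^sub>F \<alpha> in tails. R \<alpha> = P \<alpha>"
    and IH: "\<And>L \<beta> \<gamma> h. \<lbrakk>finite L; L \<subseteq> carrier G; L \<noteq> {}; h \<in> carrier G;
        \<And>k. k \<in> L \<Longrightarrow> finite (\<beta> k) \<and> \<beta> k \<subseteq> {N1..};
        \<And>k R. \<lbrakk>k \<in> L; R \<in> S0\<rbrakk> \<Longrightarrow> new_map P R k (\<beta> k) \<gamma> h \<in> PP\<rbrakk> \<Longrightarrow>
      solvable {new_map P R k (\<beta> k) \<gamma> h | R k. k \<in> L \<and> R \<in> S0}"
  shows "solvable S"
  unfolding solvable_def
proof (intro allI impI)
  fix B X W N
  assume B: "synd B" and X: "finite X" "X \<subseteq> PP" and W: "eventually W \<F>"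
  \<comment> \<open>The maps of \<open>S0\<close> are added so that the colours are generic for
    their twists as well.\<close>
  let ?X = "X \<union> S0"
  have X': "finite ?X" "?X \<subseteq> PP"
    using X S finite_subset by auto
  obtain p where p: "ultra p" "p \<le> \<F>"
    "\<And>U. eventually U p \<Longrightarrow> synd (\<lambda>x. \<forall>\<^sub>F y in p. U (x \<otimes> y))"
    using minimal_ultrafilter_exists by blast
  define adm where "adm = (\<lambda>R Q C N. eventually C \<F> \<and>
      (\<forall>c \<beta>. C c \<longrightarrow> finite \<beta> \<longrightarrow> \<beta> \<noteq> {} \<longrightarrow> \<beta> \<subseteq> {N..} \<longrightarrow>
        (\<lambda>\<alpha>. conjugate G (R \<alpha> \<otimes> inv (Q \<alpha>) \<otimes> Q (\<alpha> \<union> \<beta>) \<otimes> inv (Q \<beta>)) c) \<in> PP))"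
  have "\<forall>R\<in>PP. \<forall>Q\<in>PP. \<exists>C N. adm R Q C N"
    using PP_derivative by (simp add: adm_def)
  then obtain CC NN where "\<And>R Q. \<lbrakk>R \<in> PP; Q \<in> PP\<rbrakk> \<Longrightarrow> adm R Q (CC R Q) (NN R Q)"
    by metis
  note CC = this [unfolded adm_def, THEN conjunct1]
    and NN = this [unfolded adm_def, THEN conjunct2, rule_format]
  have "\<forall>\<^sub>F c in \<F>. \<forall>R\<in>?X. twist P R c \<in> PP"
    using X' PP_twist P by (intro eventually_ball_finite) (auto simp: twist_def quot_def)
  with eventually_star [OF W] have "\<forall>\<^sub>F c in \<F>. star W c \<and> (\<forall>R\<in>?X. twist P R c \<in> PP)"
    by (rule eventually_conj)
  from B [unfolded synd_def, rule_format, OF this]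
  obtain K where K: "finite K" "\<forall>k\<in>K. star W k \<and> (\<forall>R\<in>?X. twist P R k \<in> PP)"
    and KB: "\<forall>\<^sub>F x in \<F>. \<exists>k\<in>K. B (k \<otimes> x)"
    by (elim exE conjE)
  have "\<forall>\<^sub>F \<beta> in tails. \<forall>R\<in>S - S0. R \<beta> = P \<beta>"
    using S(1) triv by (intro eventually_ball_finite) auto
  then obtain N2 where N2: "\<And>\<beta>. \<lbrakk>finite \<beta>; \<beta> \<subseteq> {N2..}\<rbrakk> \<Longrightarrow> \<forall>R\<in>S - S0. R \<beta> = P \<beta>"
    unfolding eventually_tails by blast
  \<comment> \<open>\<open>N\<close> is the tail requested, \<open>N1\<close> serves the induction
    hypothesis, \<open>N2\<close> the maps equal to \<open>P\<close> almost everywhere, and the rest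
    condition (IV).\<close>
  let ?I = "{N, N1, N2, NN P P} \<union> (\<lambda>(k, R). NN (twist P R k) P) ` (K \<times> ?X)"
  define N0 where "N0 = Max ?I"
  have fin: "finite ?I" using K(1) X'(1) by simp
  have le: "n \<le> N0" if "n \<in> ?I" for n
    unfolding N0_def by (rule Max_ge [OF fin that])
  have N0: "N \<le> N0" "N1 \<le> N0" "N2 \<le> N0" "NN P P \<le> N0"
    by (intro le; simp)+
  have N0t: "NN (twist P R k) P \<le> N0" if "k \<in> K" "R \<in> ?X" for k R
    by (rule le, rule UnI2, rule image_eqI [of _ _ "(k, R)"]) (use that in auto)
  have Kc: "K \<subseteq> carrier G" using K(2) starD(1) by blast
  interpret foc: focusing G \<F> PP P S0 ?X W B K p CC NN N0
  proof unfold_locales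
    show "solvable {new_map P R k (\<beta> k) \<gamma> h | R k. k \<in> L \<and> R \<in> S0}"
      if "L \<subseteq> K" "L \<noteq> {}" "h \<in> carrier G" "\<And>k. k \<in> L \<Longrightarrow> finite (\<beta> k) \<and> \<beta> k \<subseteq> {N0..}"
        "\<And>k R. \<lbrakk>k \<in> L; R \<in> S0\<rbrakk> \<Longrightarrow> new_map P R k (\<beta> k) \<gamma> h \<in> PP" for L \<beta> \<gamma> h
    proof (rule IH)
      show "finite (\<beta> k) \<and> \<beta> k \<subseteq> {N1..}" if "k \<in> L" for k
        using \<open>\<And>k. k \<in> L \<Longrightarrow> finite (\<beta> k) \<and> \<beta> k \<subseteq> {N0..}\<close> [OF that] N0(2) by auto
    qed (use that Kc finite_subset [OF that(1) K(1)] in auto)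
  qed (use P X' p CC NN K KB N0(4) N0t in auto)
  obtain \<beta> k x where \<beta>: "finite \<beta>" "\<beta> \<noteq> {}" "\<beta> \<subseteq> {N0..}" and k: "k \<in> K" and x: "x \<in> carrier G"
    and WX: "\<forall>R\<in>?X. W (k \<otimes> (quot P R k \<beta> \<otimes> x))"
    and BS: "\<forall>R\<in>S0. B (k \<otimes> (quot P R k \<beta> \<otimes> x))" and Bx: "B (k \<otimes> x)"
    using foc.goal_holds unfolding foc.goal_def by (elim exE conjE)
  have kc: "k \<in> carrier G" using k Kc by blast
  define d where "d = inv (P \<beta>) \<otimes> (k \<otimes> x)"
  have d: "d \<in> carrier G" using kc x by (simp add: d_def)
  have eq: "R \<beta> \<otimes> d = k \<otimes> (quot P R k \<beta> \<otimes> x)" if "R \<in> PP" for R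
    using kc x PP_closed [OF that] by (simp add: d_def quot_def word_simps)
  have "B (R \<beta> \<otimes> d)" if "R \<in> S" for R
  proof (cases "R \<in> S0")
    case True
    with BS eq S(2) that show ?thesis by auto
  next
    case False
    have "\<beta> \<subseteq> {N2..}" using \<beta>(3) N0(3) by auto
    with N2 [OF \<beta>(1)] False that have "R \<beta> = P \<beta>" by blast
    with Bx show ?thesis using kc x by (simp add: d_def)
  qed
  moreover have "W (R \<beta> \<otimes> d)" if "R \<in> X" for R
    using WX eq that X(2) by auto
  moreover have "\<beta> \<subseteq> {N..}" using \<beta>(3) N0(1) by auto
  ultimately show "\<exists>\<alpha> d. finite \<alpha> \<and> \<alpha> \<noteq> {} \<and> \<alpha> \<subseteq> {N..} \<and> d \<in> carrier G \<and>
      (\<forall>R\<in>X. W (R \<alpha> \<otimes> d)) \<and> (\<forall>R\<in>S. B (R \<alpha> \<otimes> d))"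
    using \<beta>(1,2) d by blast
qed

end

section \<open>Induction on the weight of the quotients\<close>

locale filtered_good_system =
  good_system G \<F> PP + filtered_group G H D
  for G :: "('a, 'b) monoid_scheme" (structure) and \<F> :: "'a filter" and PP :: "(nat set \<Rightarrow> 'a) set"
    and H :: "nat \<Rightarrow> 'a set" and D :: nat +
  fixes L :: nat
  assumes H_L: "H L = {\<one>}"
begin

definition ratio :: "(nat set \<Rightarrow> 'a) \<Rightarrow> (nat set \<Rightarrow> 'a) \<Rightarrow> nat set \<Rightarrow> 'a" where
  "ratio P R = (\<lambda>\<alpha>. R \<alpha> \<otimes> inv (P \<alpha>))"

text \<open>The factor P(\<alpha> \<union> \<gamma>) P(\<gamma>)^-1, common to all new maps,
  cancels; this is why weights are measured on quotients.\<close>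

lemma ratio_new_map:
  assumes "P \<in> PP" "R \<in> PP" "R' \<in> PP" "k \<in> carrier G" "k' \<in> carrier G" "h \<in> carrier G"
  shows "ratio (new_map P R' k' \<beta>' \<gamma> h) (new_map P R k \<beta> \<gamma> h) =
    (\<lambda>\<alpha>. conjugate G (conjugate G (shift \<beta> (ratio P R) \<alpha>) k \<otimes>
      inv (conjugate G (shift \<beta>' (ratio P R') \<alpha>) k')) h)"
  using assms by (simp add: fun_eq_iff ratio_def new_map_def shift_def quot_def word_simps PP_closed)

text \<open>Maps whose quotient by \<open>P\<close> has level \<open>L\<close> agree with
  \<open>P\<close> almost everywhere. If others remain, focusing reduces to a system of smaller
  weight, obtained by dividing by a quotient \<open>ratio P R1\<close> of the deepest remaining
  level.\<close>

lemma solvable_system: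
  assumes "finite S" "S \<subseteq> PP" "P \<in> S" "\<And>R. R \<in> S \<Longrightarrow> poly 0 (ratio P R)"
  shows "solvable S"
  using assms
proof (induction "weight (ratio P ` S)" arbitrary: S P rule: wf_induct_rule [OF wf_weight_order [of L]])
  case (1 S P)
  note fin = 1(2) and SPP = 1(3) and P = 1(4) and poly0 = 1(5)
  have PPP: "P \<in> PP" using P SPP by blast
  have ratio1: "ratio P R {} = \<one>" if "R \<in> S" for R
    using that SPP PPP by (simp add: ratio_def PP_empty subset_iff)
  define S0 where "S0 = {R \<in> S. \<not> poly L (ratio P R)}"
  have triv: "\<forall>\<^sub>F \<alpha> in tails. R \<alpha> = P \<alpha>" if R: "R \<in> S - S0" for R
  proof -
    have "poly L (ratio P R)" "R \<in> PP" using R SPP by (auto simp: S0_def)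
    from poly_values [OF this(1)] show ?thesis
      unfolding H_L
    proof eventually_elim
      case (elim \<alpha>)
      then have "R \<alpha> \<otimes> inv (P \<alpha>) = \<one>" by (simp add: ratio_def)
      then show ?case
        using PP_closed [OF \<open>R \<in> PP\<close>] PP_closed [OF PPP] by (metis inv_equality inv_inv inv_closed)
    qed
  qed
  show ?case
  proof (cases "S0 = {}")
    case True
    with triv fin PPP show ?thesis by (intro solvable_trivial) auto
  next
    case False
    let ?J = "{j. j < L \<and> (\<exists>R\<in>S0. of_level j (ratio P R))}"
    have finJ: "finite ?J" by (rule finite_subset [of _ "{..<L}"]) auto
    have level: "\<exists>j\<in>?J. of_level j (ratio P R)" if R: "R \<in> S0" for R
    proof -
      have "poly 0 (ratio P R)" "\<not> poly L (ratio P R)" using R poly0 by (auto simp: S0_def)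
      then obtain j where "j < L" "of_level j (ratio P R)" by (rule ex_level)
      with R show ?thesis by blast
    qed
    then have "?J \<noteq> {}" using False by blast
    define j where "j = Max ?J"
    have "j \<in> ?J" unfolding j_def by (rule Max_in [OF finJ \<open>?J \<noteq> {}\<close>])
    then obtain R1 where R1: "R1 \<in> S0" "of_level j (ratio P R1)" and jL: "j < L" by blast
    have deepest: "poly L Q" if Q: "Q \<in> ratio P ` S" "poly (Suc j) Q" for Q
    proof (rule ccontr)
      assume nL: "\<not> poly L Q"
      from Q obtain R where R: "R \<in> S" "Q = ratio P R" by blast
      with nL have "R \<in> S0" by (simp add: S0_def)
      from level [OF this] obtain l where l: "l \<in> ?J" "of_level l Q" using R by blast
      have "l \<le> j" unfolding j_def by (rule Max_ge [OF finJ l(1)])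
      then have "poly (Suc l) Q" using poly_antimono [OF Q(2)] by simp
      with l(2) show False by (simp add: of_level_def)
    qed
    have finS0: "finite S0" and S0S: "S0 \<subseteq> S" using fin by (auto simp: S0_def)
    have "\<forall>\<^sub>F \<beta> in tails. \<forall>R\<in>S0. \<forall>i\<in>{..j}. poly i (ratio P R) \<longrightarrow>
        pcong (Suc i) (ratio P R) (shift \<beta> (ratio P R))"
      using finS0 S0S ratio1 by (intro eventually_ball_finite ballI eventually_pcong_shift) auto
    then obtain N1 where N1: "\<And>\<beta>. \<lbrakk>finite \<beta>; \<beta> \<subseteq> {N1..}\<rbrakk> \<Longrightarrow> \<forall>R\<in>S0. \<forall>i\<in>{..j}. poly i (ratio P R) \<longrightarrow>
        pcong (Suc i) (ratio P R) (shift \<beta> (ratio P R))"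
      unfolding eventually_tails by blast
    show ?thesis
    proof (rule solvable_step [OF PPP fin SPP S0S triv])
      fix Ks \<beta> \<gamma> h
      assume Ks: "finite Ks" "Ks \<subseteq> carrier G" "Ks \<noteq> {}" and h: "h \<in> carrier G"
        and \<beta>: "\<And>k. k \<in> Ks \<Longrightarrow> finite (\<beta> k) \<and> \<beta> k \<subseteq> {N1..}"
        and new: "\<And>k R. \<lbrakk>k \<in> Ks; R \<in> S0\<rbrakk> \<Longrightarrow> new_map P R k (\<beta> k) \<gamma> h \<in> PP"
      let ?S' = "{new_map P R k (\<beta> k) \<gamma> h | R k. k \<in> Ks \<and> R \<in> S0}"
      from Ks(3) obtain k1 where k1: "k1 \<in> Ks" by blast
      \<comment> \<open>Taking a new map that stems from \<open>R1\<close> as base divides the old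
        quotients by \<open>ratio P R1\<close>, up to deeper terms; the choice of the colour
        \<open>k1\<close> is arbitrary.\<close>
      define P' where "P' = new_map P R1 k1 (\<beta> k1) \<gamma> h"
      have S': "?S' = (\<lambda>(k, R). new_map P R k (\<beta> k) \<gamma> h) ` (Ks \<times> S0)" by auto
      have cong: "pcong (Suc i) (\<lambda>\<alpha>. ratio P R \<alpha> \<otimes> inv (ratio P R1 \<alpha>))
          (ratio P' (new_map P R k (\<beta> k) \<gamma> h))"
        if k: "k \<in> Ks" and R: "R \<in> S0" and i: "i \<le> j" "poly i (ratio P R)" for k R i
      proof -
        have i1: "poly i (ratio P R1)"
          using R1(2) i(1) by (auto simp: of_level_def intro: poly_antimono)
        have "pcong (Suc i) (ratio P R) (shift (\<beta> k) (ratio P R))"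
          using N1 [of "\<beta> k"] \<beta> [OF k] R i by auto
        moreover have "pcong (Suc i) (ratio P R1) (shift (\<beta> k1) (ratio P R1))"
          using N1 [of "\<beta> k1"] \<beta> [OF k1] R1(1) i(1) i1 by auto
        ultimately show ?thesis
          unfolding P'_def
          using pcong_new_system [OF i(2) i1 _ _ _ _ h, of "\<beta> k" "\<beta> k1" k k1] k k1 Ks(2)
            ratio_new_map [OF PPP _ _ _ _ h, of R R1 k k1] R R1(1) S0S SPP by (simp add: subset_iff)
      qed
      have new_ratio: "\<exists>Q\<in>ratio P ` S. \<not> poly L Q \<and>
          (\<forall>i\<le>j. poly i Q \<longrightarrow> pcong (Suc i) (\<lambda>\<alpha>. Q \<alpha> \<otimes> inv (ratio P R1 \<alpha>)) Q')"
        if "Q' \<in> ratio P' ` ?S'" for Q'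
      proof -
        from that obtain k R where kR: "k \<in> Ks" "R \<in> S0" "Q' = ratio P' (new_map P R k (\<beta> k) \<gamma> h)"
          by blast
        then show ?thesis
          using cong [OF kR(1,2)] S0S by (intro bexI [of _ "ratio P R"]) (auto simp: S0_def)
      qed
      have fr: "finite (ratio P ` S)" using fin by simp
      have pr: "poly 0 Q" if "Q \<in> ratio P ` S" for Q using that poly0 by auto
      have R1S: "ratio P R1 \<in> ratio P ` S" using R1(1) S0S by blast
      note dec = weight_decrease [OF fr pr R1S R1(2) deepest new_ratio]
      show "solvable ?S'"
      proof (rule 1(1))
        show "(weight (ratio P' ` ?S'), weight (ratio P ` S)) \<in>
            {(f, g). \<exists>j<L. f j < g j \<and> (\<forall>i<j. f i \<le> g i)}"
          using dec jL by blast
        show "finite ?S'" unfolding S' using Ks(1) finS0 by simp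
        show "?S' \<subseteq> PP" using new by blast
        show "P' \<in> ?S'" unfolding P'_def using k1 R1(1) by blast
        show "poly 0 (ratio P' R')" if "R' \<in> ?S'" for R'
        proof -
          from that obtain k R where kR: "k \<in> Ks" "R \<in> S0" "R' = new_map P R k (\<beta> k) \<gamma> h"
            by blast
          have 0: "poly 0 (ratio P R)" "poly 0 (ratio P R1)" using kR(2) R1(1) S0S poly0 by auto
          from poly_pcong [OF poly.mult [OF 0(1) poly.inverse [OF 0(2)]]
              pcong_antimono [OF cong [OF kR(1,2) _ 0(1)]]] kR(3)
          show ?thesis by simp
        qed
      qed
    qed
  qed
qed

end

section \<open>Filters of sets and extensional maps\<close>

definition set_filter :: "('a, 'b) monoid_scheme \<Rightarrow> 'a set set \<Rightarrow> 'a filter" where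
  "set_filter G F = Abs_filter (\<lambda>P. {x \<in> carrier G. P x} \<in> F)"

lemma eventually_set_filter:
  assumes "filter_on G F"
  shows "eventually P (set_filter G F) \<longleftrightarrow> {x \<in> carrier G. P x} \<in> F"
  unfolding set_filter_def
proof (rule eventually_Abs_filter, unfold_locales)
  have up: "\<And>U V. \<lbrakk>U \<in> F; U \<subseteq> V; V \<subseteq> carrier G\<rbrakk> \<Longrightarrow> V \<in> F" and ne: "F \<noteq> {}"
    and inter: "\<And>U V. \<lbrakk>U \<in> F; V \<in> F\<rbrakk> \<Longrightarrow> U \<inter> V \<in> F" and sub: "F \<subseteq> Pow (carrier G)"
    using assms by (auto simp: filter_on_def)
  from ne obtain U where "U \<in> F" by blast
  with up [of U "carrier G"] sub have "carrier G \<in> F" by blast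
  then show "{x \<in> carrier G. True} \<in> F" by simp
  show "{x \<in> carrier G. P x \<and> Q x} \<in> F" if "{x \<in> carrier G. P x} \<in> F" "{x \<in> carrier G. Q x} \<in> F" for P Q
    using inter [OF that] by (simp add: Collect_conj_eq Int_ac)
  show "{x \<in> carrier G. Q x} \<in> F" if "\<forall>x. P x \<longrightarrow> Q x" "{x \<in> carrier G. P x} \<in> F" for P Q
    by (rule up [OF that(2)]) (use that(1) in auto)
qed

lemma idempotent_set_filter:
  assumes "group G" "idempotent_filter G F"
  shows "idempotent_group_filter G (set_filter G F)"
proof -
  interpret group G by (rule assms)
  have F: "filter_on G F" and idem: "F \<subseteq> filter_prod G F F"
    using assms(2) by (auto simp: idempotent_filter_def)
  note ev = eventually_set_filter [OF F]
  show ?thesis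
  proof unfold_locales
    show "set_filter G F \<noteq> bot"
      using F by (simp add: eventually_False [symmetric] ev filter_on_def)
    show "\<forall>\<^sub>F x in set_filter G F. x \<in> carrier G"
      using ev [of "\<lambda>_. True"] by (simp add: ev)
    fix P assume "eventually P (set_filter G F)"
    then have "{x \<in> carrier G. P x} \<in> filter_prod G F F"
      using idem by (auto simp: ev)
    then have "{x \<in> carrier G. {y \<in> carrier G. x \<otimes>\<^bsub>G\<^esub> y \<in> {x \<in> carrier G. P x}} \<in> F} \<in> F"
      by (simp add: filter_prod_def)
    then have "\<forall>\<^sub>F x in set_filter G F. \<forall>\<^sub>F y in set_filter G F. x \<otimes>\<^bsub>G\<^esub> y \<in> {x \<in> carrier G. P x}"
      by (simp add: ev)
    then show "\<forall>\<^sub>F x in set_filter G F. \<forall>\<^sub>F y in set_filter G F. P (x \<otimes>\<^bsub>G\<^esub> y)"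
      by eventually_elim (erule eventually_mono, simp)
  qed
qed

text \<open>
  Values at infinite sets are left unconstrained because the formulas of conditions (III) and (IV)
  do not produce a fixed value there.
\<close>

definition total_maps :: "('a, 'b) monoid_scheme \<Rightarrow> (nat set \<Rightarrow> 'a) set \<Rightarrow> (nat set \<Rightarrow> 'a) set" where
  "total_maps G \<P> = {Q. (\<forall>\<alpha>. Q \<alpha> \<in> carrier G) \<and> Q {} = \<one>\<^bsub>G\<^esub> \<and> restrict Q FN \<in> \<P>}"

lemma good_system_total_maps:
  assumes G: "group G" and F: "idempotent_filter G F" and good: "good_collection G F \<P>"
  shows "good_system G (set_filter G F) (total_maps G \<P>)"
proof -
  interpret idempotent_group_filter G "set_filter G F"
    by (rule idempotent_set_filter [OF G F])
  have fo: "filter_on G F" using F by (simp add: idempotent_filter_def)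
  note ev = eventually_set_filter [OF fo]
  show ?thesis
  proof unfold_locales
    fix R \<alpha> assume "R \<in> total_maps G \<P>"
    then show "R \<alpha> \<in> carrier G" "R {} = \<one>\<^bsub>G\<^esub>" by (simp_all add: total_maps_def)
  next
    fix R V assume R: "R \<in> total_maps G \<P>" and V: "eventually V (set_filter G F)"
    have "\<forall>V\<in>F. {\<alpha>\<in>FN. restrict R FN \<alpha> \<in> V \<union> {\<one>\<^bsub>G\<^esub>}} \<in> EE"
      using good R unfolding good_collection_def filter_measurable_def total_maps_def by blast
    with V have "{\<alpha>\<in>FN. restrict R FN \<alpha> \<in> {x \<in> carrier G. V x} \<union> {\<one>\<^bsub>G\<^esub>}} \<in> EE"
      unfolding ev by blast
    from EE_eventually_tails [OF this] show "\<forall>\<^sub>F \<alpha> in tails. R \<alpha> = \<one>\<^bsub>G\<^esub> \<or> V (R \<alpha>)"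
    proof eventually_elim
      case (elim \<alpha>)
      show ?case
      proof (cases "\<alpha> = {}")
        case True
        with R show ?thesis by (simp add: total_maps_def)
      qed (use elim in auto)
    qed
  next
    fix R P assume R: "R \<in> total_maps G \<P>" and P: "P \<in> total_maps G \<P>"
    have [simp]: "R \<alpha> \<in> carrier G" "P \<alpha> \<in> carrier G" for \<alpha>
      using R P by (simp_all add: total_maps_def)
    have e: "R {} = \<one>\<^bsub>G\<^esub>" "P {} = \<one>\<^bsub>G\<^esub>" using R P by (simp_all add: total_maps_def)
    have RP: "restrict R FN \<in> \<P>" "restrict P FN \<in> \<P>" using R P by (simp_all add: total_maps_def)
    have "\<forall>\<^sub>F c in set_filter G F. (\<lambda>\<alpha>\<in>FN. conjugate G (restrict R FN \<alpha>) c \<otimes>\<^bsub>G\<^esub>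
        commutator G c (restrict P FN \<alpha>)) \<in> \<P>"
      using good RP unfolding good_collection_def ev by blast
    with \<F>_carrier show "\<forall>\<^sub>F c in set_filter G F.
        (\<lambda>\<alpha>. conjugate G (R \<alpha> \<otimes>\<^bsub>G\<^esub> inv\<^bsub>G\<^esub> P \<alpha>) c \<otimes>\<^bsub>G\<^esub> P \<alpha>) \<in> total_maps G \<P>"
    proof eventually_elim
      case (elim c)
      have "(\<lambda>\<alpha>\<in>FN. conjugate G (restrict R FN \<alpha>) c \<otimes>\<^bsub>G\<^esub> commutator G c (restrict P FN \<alpha>)) =
          (\<lambda>\<alpha>\<in>FN. conjugate G (R \<alpha> \<otimes>\<^bsub>G\<^esub> inv\<^bsub>G\<^esub> P \<alpha>) c \<otimes>\<^bsub>G\<^esub> P \<alpha>)"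
        by (rule restrict_ext) (use elim in \<open>simp add: word_simps\<close>)
      with elim show ?case by (simp add: total_maps_def e conjugate_def)
    qed
    obtain C T where C: "C \<in> F" and T: "T \<in> EE"
      and CT: "\<And>c \<beta>. \<lbrakk>c \<in> C; \<beta> \<in> T\<rbrakk> \<Longrightarrow> (\<lambda>\<alpha>\<in>FN. conjugate G (restrict R FN \<alpha> \<otimes>\<^bsub>G\<^esub>
        derivative G \<beta> (restrict P FN) \<alpha>) c) \<in> \<P>"
      using good RP unfolding good_collection_def by blast
    have Cc: "C \<subseteq> carrier G" using C fo by (auto simp: filter_on_def)
    then have "{x \<in> carrier G. x \<in> C} = C" by blast
    with C have evC: "\<forall>\<^sub>F c in set_filter G F. c \<in> C" by (simp add: ev)
    from EE_eventually_tails [OF T] obtain N where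
      N: "\<And>\<beta>. \<lbrakk>finite \<beta>; \<beta> \<subseteq> {N..}; \<beta> \<noteq> {}\<rbrakk> \<Longrightarrow> \<beta> \<in> T"
      unfolding eventually_tails by blast
    have "(\<lambda>\<alpha>. conjugate G (R \<alpha> \<otimes>\<^bsub>G\<^esub> inv\<^bsub>G\<^esub> P \<alpha> \<otimes>\<^bsub>G\<^esub> P (\<alpha> \<union> \<beta>) \<otimes>\<^bsub>G\<^esub> inv\<^bsub>G\<^esub> P \<beta>) c) \<in> total_maps G \<P>"
      if c: "c \<in> C" and \<beta>: "finite \<beta>" "\<beta> \<noteq> {}" "\<beta> \<subseteq> {N..}" for c \<beta>
    proof -
      have cc [simp]: "c \<in> carrier G" using c Cc by blast
      have "\<beta> \<in> FN" using \<beta> by (simp add: FN_def)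
      then have "(\<lambda>\<alpha>\<in>FN. conjugate G (restrict R FN \<alpha> \<otimes>\<^bsub>G\<^esub> derivative G \<beta> (restrict P FN) \<alpha>) c) =
          (\<lambda>\<alpha>\<in>FN. conjugate G (R \<alpha> \<otimes>\<^bsub>G\<^esub> inv\<^bsub>G\<^esub> P \<alpha> \<otimes>\<^bsub>G\<^esub> P (\<alpha> \<union> \<beta>) \<otimes>\<^bsub>G\<^esub> inv\<^bsub>G\<^esub> P \<beta>) c)"
        by (intro restrict_ext) (auto simp: derivative_def m_assoc FN_def)
      with CT [OF c N [OF \<beta>(1,3,2)]] show ?thesis by (simp add: total_maps_def e conjugate_def)
    qed
    with evC show "\<exists>C N. eventually C (set_filter G F) \<and> (\<forall>c \<beta>. C c \<longrightarrow> finite \<beta> \<longrightarrow> \<beta> \<noteq> {} \<longrightarrow> \<beta> \<subseteq> {N..} \<longrightarrow>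
        (\<lambda>\<alpha>. conjugate G (R \<alpha> \<otimes>\<^bsub>G\<^esub> inv\<^bsub>G\<^esub> P \<alpha> \<otimes>\<^bsub>G\<^esub> P (\<alpha> \<union> \<beta>) \<otimes>\<^bsub>G\<^esub> inv\<^bsub>G\<^esub> P \<beta>) c) \<in> total_maps G \<P>)"
      by (intro exI [of _ "\<lambda>c. c \<in> C"] exI [of _ N]) blast
  qed
qed

lemma synd_of_syndetic:
  assumes G: "group G" and F: "idempotent_filter G F" and A: "syndetic G F A"
  shows "idempotent_group_filter.synd G (set_filter G F) (\<lambda>x. x \<in> A)"
proof -
  interpret idempotent_group_filter G "set_filter G F"
    by (rule idempotent_set_filter [OF G F])
  have fo: "filter_on G F" using F by (simp add: idempotent_filter_def)
  note ev = eventually_set_filter [OF fo]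
  have Ac: "A \<subseteq> carrier G" using A by (simp add: syndetic_def)
  show ?thesis
    unfolding synd_def
  proof (intro allI impI)
    fix V assume "eventually V (set_filter G F)"
    then obtain K where K: "finite K" "K \<subseteq> {x \<in> carrier G. V x}" "(set_inv\<^bsub>G\<^esub> K) <#>\<^bsub>G\<^esub> A \<in> F"
      using A unfolding syndetic_def ev by blast
    have "(set_inv\<^bsub>G\<^esub> K) <#>\<^bsub>G\<^esub> A \<subseteq> {x \<in> carrier G. \<exists>k\<in>K. k \<otimes>\<^bsub>G\<^esub> x \<in> A}"
    proof
      fix y assume "y \<in> (set_inv\<^bsub>G\<^esub> K) <#>\<^bsub>G\<^esub> A"
      then obtain l a where "l \<in> K" "a \<in> A" and y: "y = inv\<^bsub>G\<^esub> l \<otimes>\<^bsub>G\<^esub> a"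
        by (auto simp: SET_INV_def set_mult_def)
      moreover from this K(2) Ac have "l \<in> carrier G" "a \<in> carrier G" by auto
      ultimately have "y \<in> carrier G" "l \<otimes>\<^bsub>G\<^esub> y = a" by simp_all
      with \<open>l \<in> K\<close> \<open>a \<in> A\<close> show "y \<in> {x \<in> carrier G. \<exists>k\<in>K. k \<otimes>\<^bsub>G\<^esub> x \<in> A}" by blast
    qed
    then have "\<forall>\<^sub>F x in set_filter G F. \<exists>k\<in>K. k \<otimes>\<^bsub>G\<^esub> x \<in> A"
      using K(3) fo unfolding ev filter_on_def by auto
    with K show "\<exists>K. finite K \<and> (\<forall>k\<in>K. V k) \<and> (\<forall>\<^sub>F x in set_filter G F. \<exists>k\<in>K. k \<otimes>\<^bsub>G\<^esub> x \<in> A)"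
      by blast
  qed
qed

theorem theoremA:
  fixes G :: "('a, 'b) monoid_scheme" (structure)
    and F :: "'a set set"
    and \<P> :: "(nat set \<Rightarrow> 'a) set"
    and P :: "nat \<Rightarrow> nat set \<Rightarrow> 'a"
    and k :: nat
    and A :: "'a set"
  assumes "nilpotent_group G"
    and "idempotent_filter G F"
    and "good_collection G F \<P>"
    and "\<forall>i\<in>{1..k}. P i \<in> \<P>"
    and "syndetic G F A"
  shows "\<exists>\<alpha>\<in>FN. \<exists>a\<in>carrier G. {P i \<alpha> \<otimes> a | i. i \<in> {1..k}} \<subseteq> A"
proof (cases "k = 0")
  case True
  interpret group G using assms(1) by (simp add: nilpotent_group_def)
  have "{0} \<in> FN" by (simp add: FN_def)
  moreover have "{P i {0} \<otimes> \<one> | i. i \<in> {1..k}} \<subseteq> A" using True by auto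
  ultimately show ?thesis using one_closed by blast
next
  case False
  have G: "group G" using assms(1) by (simp add: nilpotent_group_def)
  interpret group G by (rule G)
  obtain n where n: "lower_central_series G n = {\<one>}"
    using assms(1) by (auto simp: nilpotent_group_def)
  have poly: "\<forall>i\<in>{1..k}. \<exists>d\<ge>1. polynomial_of_degree G d (P i)"
    using assms(3,4) by (simp add: good_collection_def polynomial_mapping_def)
  then obtain deg where deg: "\<And>i. i \<in> {1..k} \<Longrightarrow> 1 \<le> deg i \<and> polynomial_of_degree G (deg i) (P i)"
    by metis
  define D where "D = Max (deg ` {1..k})"
  have degD: "deg i \<le> D" if "i \<in> {1..k}" for i
    unfolding D_def using that by (intro Max_ge) auto
  have D: "1 \<le> D" using degD [of 1] deg [of 1] False by simp
  interpret filtered_group G "\<lambda>j. lower_central_series G ((j - 1) div D)" D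
    by (rule filtered_group_lower_central_series [OF D])
  interpret good_system G "set_filter G F" "total_maps G \<P>"
    by (rule good_system_total_maps [OF G assms(2,3)])
  \<comment> \<open>Since (Suc (n D) - 1) div D = n, level \<open>Suc (n * D)\<close> is the trivial
    term of the series.\<close>
  interpret filtered_good_system G "set_filter G F" "total_maps G \<P>"
    "\<lambda>j. lower_central_series G ((j - 1) div D)" D "Suc (n * D)"
    by unfold_locales (use n D in simp)
  have P_fun: "P i \<in> FN \<rightarrow>\<^sub>E carrier G" if i: "i \<in> {1..k}" for i
  proof -
    obtain d where "deg i = Suc d" using deg [OF i] by (cases "deg i") auto
    then show ?thesis using deg [OF i] by (cases d) auto
  qed
  \<comment> \<open>Extension by \<open>\<one>\<close> outside \<open>FN\<close> provides the value
    at the empty set that \<open>poly\<close> and \<open>total_maps\<close> require.\<close>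
  define Q where "Q = (\<lambda>i \<alpha>. if \<alpha> \<in> FN then P i \<alpha> else \<one>)"
  have Qr: "restrict (Q i) FN = P i" if "i \<in> {1..k}" for i
    using P_fun [OF that] by (auto simp: Q_def PiE_def extensional_def restrict_def)
  have Qc: "Q i \<alpha> \<in> carrier G" if "i \<in> {1..k}" for i \<alpha>
    using P_fun [OF that] by (auto simp: Q_def)
  have Q1: "Q i {} = \<one>" for i by (simp add: Q_def FN_def)
  let ?S = "Q ` {1..k}"
  have Qpoly: "poly 0 (Q i)" if "i \<in> {1..k}" for i
    by (rule base [of _ "deg i"]) (use that Qc Q1 Qr deg degD in auto)
  have one: "1 \<in> {1..k}" using False by simp
  have SPP: "?S \<subseteq> total_maps G \<P>"
    using Qc Q1 Qr assms(4) by (auto simp: total_maps_def)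
  have "solvable ?S"
  proof (rule solvable_system [OF _ SPP])
    show "Q 1 \<in> ?S" using one by blast
    show "poly 0 (ratio (Q 1) R)" if "R \<in> ?S" for R
      unfolding ratio_def using that Qpoly
      by (intro poly.mult poly.inverse Qpoly [OF one]) auto
  qed simp
  from solvableD [OF this synd_of_syndetic [OF G assms(2,5)], of "{}" "\<lambda>_. True" 0]
  obtain \<alpha> a where \<alpha>: "finite \<alpha>" "\<alpha> \<noteq> {}" "a \<in> carrier G" and A: "\<forall>R\<in>?S. R \<alpha> \<otimes> a \<in> A"
    by auto
  have FN: "\<alpha> \<in> FN" using \<alpha> by (simp add: FN_def)
  have "P i \<alpha> \<otimes> a \<in> A" if "i \<in> {1..k}" for i
    using bspec [OF A, of "Q i"] that FN by (auto simp: Q_def)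
  with FN \<alpha>(3) show ?thesis by blast
qed

end
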